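(* Let $(X_t)_{t\ge 0}$, $(\mathbb{P}_x)_{x\in E}$ be an irreducible Markov jump process on the finite set $E$ with invariant distribution $\pi$ and generator $L$, let $f:E\to\mathbb{R}$ be non-constant with $\pi(f)=0$, let $\nu$ be a probability measure on $E$, and let $A_t=\int_0^t f(X_s)\,ds$ for $t>0$. Let $\alpha:[0,\infty)\to[0,\infty]$ be some function satisfying $$\alpha(\beta(f))\le I(\beta\,|\,\pi)$$ for all probability measures $\beta$ on $E$ such that $\beta(f)\ge0$. Then for all $u\ge0$ $$\mathbb{P}_\nu\left(\frac{A_t}{t}\ge u\right)\le\left\|\frac{d\nu}{d\pi}\right\|_2e^{-t\alpha(u)}.$$ Furthermore, $\lambda_0(r)\le\alpha^*(r)$ for all $r\ge0$, where $\alpha^*(r)=\sup_{u\ge0}(ru-\alpha(u))$ denotes the Fenchel conjugate of $\alpha$ with respect to $\mathbb{R}_{\ge0}$.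
   Context: $E$ is a finite set with at least two elements. A Markov jump process (MJP) on $E$ is an $E$-valued process $(X_t)_{t\ge0}$ with right-continuous (piecewise constant) paths together with probability measures $(\mathbb{P}_x)_{x\in E}$ such that $\mathbb{P}_x(X_0=x)=1$ and the (time-homogeneous) Markov property holds. Its transition function is $p_{xy}(t)=\mathbb{P}_x(X_t=y)=(\exp(tQ))_{xy}$ for a unique matrix $Q=(q_{xy})$ with $q_{xy}\ge0$ for $x\ne y$ and $\sum_y q_{xy}=0$. It is irreducible if $p_{xy}(t)>0$ for all $x,y\in E$, $t>0$; then it has a unique invariant distribution $\pi$ ($\pi^TQ=0$), and $\pi_x>0$ for all $x$. Write $\mathbb{P}_\nu=\sum_x\nu_x\mathbb{P}_x$ for a probability measure $\nu$ on $E$, and $\mu(g)=\int g\,d\mu$. $L^2(\pi)$ is the real space of all functions $E\to\mathbb{R}$ with inner product $\langle g,h\rangle=\sum_x g(x)h(x)\pi_x$ and norm $\|\cdot\|_2$. The infinitesimal generator $L$ is the operator on $L^2(\pi)$ given by $(Lg)(x)=\sum_y q_{xy}g(y)$, and $L^*$ is its adjoint in $L^2(\pi)$. $M_f$ is multiplication by $f$, and $\frac{d\nu}{d\pi}(x)=\nu_x/\pi_x$. For $r\in\mathbb{R}$, $\lambda_0(r)$ denotes the largest eigenvalue of the self-adjoint operator $\frac{L+L^*}{2}+rM_f$ on $L^2(\pi)$. The Donsker–Varadhan information of a probability measure $\beta$ on $E$ is $I(\beta\,|\,\pi)=-\left\langle L\left(\frac{d\beta}{d\pi}\right)^{1/2},\left(\frac{d\beta}{d\pi}\right)^{1/2}\right\rangle$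 (every $\beta$ is absolutely continuous with respect to $\pi$ since $\pi_x>0$). Conventions: $e^{-\infty}=0$, $c-\infty=-\infty$ for real $c$. *)

theory Defs
  imports "HOL-Probability.Probability"
begin

text \<open>The finite state space is the type \<open>'e::finite\<close>; probability measures on it are
  of type \<open>'e pmf\<close>, and real functions on it are of type \<open>'e \<Rightarrow> real\<close>.\<close>

definition natural_filtration ::
    "'w measure \<Rightarrow> (real \<Rightarrow> 'w \<Rightarrow> 'e) \<Rightarrow> real \<Rightarrow> 'w measure" where
  "natural_filtration M X s =
     sigma (space M) {X u -` A \<inter> space M | u A. 0 \<le> u \<and> u \<le> s}"

definition transition_prob ::
    "'w measure \<Rightarrow> (real \<Rightarrow> 'w \<Rightarrow> 'e) \<Rightarrow> ('e \<Rightarrow> 'w measure) \<Rightarrow> real \<Rightarrow> 'e \<Rightarrow> 'e \<Rightarrow> real" where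
  "transition_prob M X P t x y = measure (P x) {\<omega> \<in> space M. X t \<omega> = y}"

text \<open>\<open>M\<close> only supplies the measurable space \<open>(\<Omega>, F)\<close>; its measure is irrelevant. Times range
  over \<open>[0, \<infinity>)\<close>, so nothing is required of \<open>X t\<close> for \<open>t < 0\<close>. Since \<open>'e\<close> carries the discrete
  topology, convergence of a path means being eventually constant. Right-continuity together with
  the existence of left limits says exactly that each path is right-continuous and piecewise
  constant with finitely many jumps in every bounded time interval.\<close>

locale markov_jump_process =
  fixes M :: "'w measure"
    and X :: "real \<Rightarrow> 'w \<Rightarrow> 'e::finite"
    and P :: "'e \<Rightarrow> 'w measure"
  assumes prob_space_P: "prob_space (P x)"
    and sets_P: "sets (P x) = sets M"
    and measurable_X: "0 \<le> t \<Longrightarrow> X t \<in> measurable M (count_space UNIV)"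
    and right_continuous:
      "\<omega> \<in> space M \<Longrightarrow> 0 \<le> t \<Longrightarrow> eventually (\<lambda>s. X s \<omega> = X t \<omega>) (at_right t)"
    and left_limits:
      "\<omega> \<in> space M \<Longrightarrow> 0 < t \<Longrightarrow> \<exists>y. eventually (\<lambda>s. X s \<omega> = y) (at_left t)"
    and initial: "measure (P x) {\<omega> \<in> space M. X 0 \<omega> = x} = 1"
    and markov: "0 \<le> s \<Longrightarrow> 0 \<le> t \<Longrightarrow>
      AE \<omega> in P x.
        real_cond_exp (P x) (natural_filtration M X s)
          (indicator {\<omega> \<in> space M. X (s + t) \<omega> = y}) \<omega>
        = transition_prob M X P t (X s \<omega>) y"

definition irreducible_process ::
    "'w measure \<Rightarrow> (real \<Rightarrow> 'w \<Rightarrow> 'e) \<Rightarrow> ('e \<Rightarrow> 'w measure) \<Rightarrow> bool" where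
  "irreducible_process M X P \<longleftrightarrow> (\<forall>t>0. \<forall>x y. transition_prob M X P t x y > 0)"

text \<open>The operations \<open>*\<close> and \<open>^\<close> on \<open>real ^ 'n ^ 'n\<close> are componentwise, so the constant \<open>exp\<close>
  cannot be used for matrices; the exponential series is formed with the matrix product \<open>**\<close>.\<close>

definition matrix_exp :: "real ^ 'n ^ 'n \<Rightarrow> real ^ 'n ^ 'n" where
  "matrix_exp A = (\<Sum>n. (((**) A ^^ n) (mat 1)) /\<^sub>R fact n)"

text \<open>\<open>Q\<close> is the (necessarily unique) matrix of jump rates of the process.\<close>

definition rate_matrix ::
    "'w measure \<Rightarrow> (real \<Rightarrow> 'w \<Rightarrow> 'e) \<Rightarrow> ('e::finite \<Rightarrow> 'w measure) \<Rightarrow> real ^ 'e ^ 'e \<Rightarrow> bool" where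
  "rate_matrix M X P Q \<longleftrightarrow>
     (\<forall>x y. x \<noteq> y \<longrightarrow> Q $ x $ y \<ge> 0) \<and>
     (\<forall>x. (\<Sum>y\<in>UNIV. Q $ x $ y) = 0) \<and>
     (\<forall>t\<ge>0. \<forall>x y. transition_prob M X P t x y = matrix_exp (t *\<^sub>R Q) $ x $ y)"

definition invariant_distribution :: "real ^ 'e ^ 'e \<Rightarrow> 'e::finite pmf \<Rightarrow> bool" where
  "invariant_distribution Q \<pi> \<longleftrightarrow> (\<forall>y. (\<Sum>x\<in>UNIV. pmf \<pi> x * Q $ x $ y) = 0)"

definition prob_initial ::
    "('e::finite \<Rightarrow> 'w measure) \<Rightarrow> 'e pmf \<Rightarrow> 'w set \<Rightarrow> real" where
  "prob_initial P \<nu> A = (\<Sum>x\<in>UNIV. pmf \<nu> x * measure (P x) A)"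

definition additive_functional ::
    "(real \<Rightarrow> 'w \<Rightarrow> 'e) \<Rightarrow> ('e \<Rightarrow> real) \<Rightarrow> real \<Rightarrow> 'w \<Rightarrow> real" where
  "additive_functional X f t \<omega> = (LINT s:{0..t}|lborel. f (X s \<omega>))"

definition inner_L2 :: "'e::finite pmf \<Rightarrow> ('e \<Rightarrow> real) \<Rightarrow> ('e \<Rightarrow> real) \<Rightarrow> real" where
  "inner_L2 \<pi> g h = (\<Sum>x\<in>UNIV. g x * h x * pmf \<pi> x)"

definition norm_L2 :: "'e::finite pmf \<Rightarrow> ('e \<Rightarrow> real) \<Rightarrow> real" where
  "norm_L2 \<pi> g = sqrt (inner_L2 \<pi> g g)"

definition pmf_density :: "'e pmf \<Rightarrow> 'e pmf \<Rightarrow> 'e \<Rightarrow> real" where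
  "pmf_density \<nu> \<pi> x = pmf \<nu> x / pmf \<pi> x"

definition generator :: "real ^ 'e ^ 'e \<Rightarrow> ('e::finite \<Rightarrow> real) \<Rightarrow> 'e \<Rightarrow> real" where
  "generator Q g x = (\<Sum>y\<in>UNIV. Q $ x $ y * g y)"

text \<open>The library constant \<open>adjoint\<close> refers to the inner product of a type, not to the
  \<open>\<pi>\<close>-weighted one. If \<open>\<pi>\<close> is everywhere positive, the adjoint of a linear \<open>T\<close> is unique.\<close>

definition adjoint_L2 ::
    "'e::finite pmf \<Rightarrow> (('e \<Rightarrow> real) \<Rightarrow> 'e \<Rightarrow> real) \<Rightarrow> ('e \<Rightarrow> real) \<Rightarrow> 'e \<Rightarrow> real" where
  "adjoint_L2 \<pi> T = (SOME S. \<forall>g h. inner_L2 \<pi> (T g) h = inner_L2 \<pi> g (S h))"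

definition tilted_operator ::
    "real ^ 'e ^ 'e \<Rightarrow> 'e::finite pmf \<Rightarrow> ('e \<Rightarrow> real) \<Rightarrow> real \<Rightarrow> ('e \<Rightarrow> real) \<Rightarrow> 'e \<Rightarrow> real" where
  "tilted_operator Q \<pi> f r g x =
     (generator Q g x + adjoint_L2 \<pi> (generator Q) g x) / 2 + r * (f x * g x)"

definition operator_eigenvalue :: "(('e \<Rightarrow> real) \<Rightarrow> 'e \<Rightarrow> real) \<Rightarrow> real \<Rightarrow> bool" where
  "operator_eigenvalue T c \<longleftrightarrow> (\<exists>g. g \<noteq> (\<lambda>x. 0) \<and> T g = (\<lambda>x. c * g x))"

definition lambda0 ::
    "real ^ 'e ^ 'e \<Rightarrow> 'e::finite pmf \<Rightarrow> ('e \<Rightarrow> real) \<Rightarrow> real \<Rightarrow> real" where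
  "lambda0 Q \<pi> f r = (GREATEST c. operator_eigenvalue (tilted_operator Q \<pi> f r) c)"

definition DV_information :: "real ^ 'e ^ 'e \<Rightarrow> 'e::finite pmf \<Rightarrow> 'e pmf \<Rightarrow> real" where
  "DV_information Q \<pi> \<beta> =
     - inner_L2 \<pi> (generator Q (\<lambda>x. sqrt (pmf_density \<beta> \<pi> x))) (\<lambda>x. sqrt (pmf_density \<beta> \<pi> x))"

definition exp_ereal :: "ereal \<Rightarrow> ereal" where
  "exp_ereal c = (case c of ereal x \<Rightarrow> ereal (exp x) | PInfty \<Rightarrow> \<infinity> | MInfty \<Rightarrow> 0)"

definition fenchel_conjugate :: "(real \<Rightarrow> ereal) \<Rightarrow> real \<Rightarrow> ereal" where
  "fenchel_conjugate \<alpha> r = (SUP u\<in>{0..}. ereal (r * u) - \<alpha> u)"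

end

theory Submission
  imports Defs
begin

text \<open>
  Fix \<open>r \<ge> 0\<close> and let \<open>c\<close> bound \<open>r \<beta>(f) - I(\<beta>|\<pi>)\<close> over all probability measures \<open>\<beta>\<close>. Every
  nonzero \<open>g\<close> gives a \<open>\<beta>\<close> with density proportional to \<open>g\<^sup>2\<close>, and replacing \<open>g\<close> by \<open>|g|\<close> can only
  lower the Dirichlet form \<open>-\<langle>Lg, g\<rangle>\<close>; hence the bound on measures is the same as the quadratic form
  bound \<open>\<langle>Lg, g\<rangle> + r \<langle>fg, g\<rangle> \<le> c \<parallel>g\<parallel>\<^sup>2\<close> (\<open>form_le_if_variational_le\<close>). The smallest such \<open>c\<close> is
  attained, by compactness of the simplex, and is \<open>\<lambda>\<^sub>0(r)\<close> (\<open>lambda0_variational\<close>). An optimal \<open>\<beta>\<close> has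
  \<open>r \<beta>(f) \<ge> I(\<beta>|\<pi>) \<ge> 0\<close>, since \<open>\<pi>\<close> itself gives the value \<open>0\<close>; so for \<open>r > 0\<close> the hypothesis on \<open>\<alpha>\<close>
  applies to it, and \<open>\<lambda>\<^sub>0(r) \<le> r \<beta>(f) - \<alpha>(\<beta>(f))\<close>, which is at most \<open>\<alpha>\<^sup>*(r)\<close>.

  For the tail bound, Markov's inequality reduces the claim to
  \<open>E\<^sub>\<nu>[exp (r A\<^sub>t)] \<le> \<parallel>d\<nu>/d\<pi>\<parallel>\<^sub>2 exp (t c)\<close> (\<open>exponential_moment_le\<close>). Now
  \<open>A\<^sub>t\<close> is the limit of its right Riemann sums, and the exponential moment of a Riemann
  sum with mesh \<open>h\<close> is, by the Markov property, an iterate of the operator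
  \<open>g \<mapsto> exp (hQ) (exp (h r f) g)\<close> applied to \<open>1\<close> (\<open>expectation_product_along_grid\<close>). Differentiating at
  \<open>h = 0\<close> shows that one step multiplies the squared norm by at most \<open>exp (2h (c + \<epsilon>))\<close> once \<open>h\<close> is
  small (\<open>tilted_step_norm_growth\<close>). Multiplying the steps and using the Cauchy--Schwarz inequality
  against \<open>d\<nu>/d\<pi>\<close> gives the moment bound.

  It remains to choose \<open>r\<close>. By hypothesis, \<open>\<alpha>\<close> lies below
  \<open>J(u) = inf {I(\<beta>|\<pi>) | \<beta>(f) = u}\<close>, which is convex and lower semicontinuous because \<open>I\<close> is convex and
  continuous on the compact simplex. Separating the point \<open>(u, \<alpha>(u) - \<epsilon>)\<close> from the closed convex
  region above the graph of \<open>J\<close> yields an \<open>r \<ge> 0\<close> with \<open>r u - c \<ge> \<alpha>(u) - \<epsilon>\<close>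
  (\<open>exists_tangent_slope\<close>); then \<open>\<epsilon> \<rightarrow> 0\<close>. If \<open>u\<close> exceeds the maximum of \<open>f\<close>, no measure has mean \<open>u\<close>
  and \<open>\<alpha>(u)\<close> may be infinite, but then the event is empty.
\<close>

section \<open>The exponential series of a rate matrix\<close>

lemma matrix_power_entry_bound:
  fixes A :: "real ^ 'n ^ 'n"
  shows "\<bar>((**) A ^^ n) (mat 1) $ x $ y\<bar> \<le> (\<Sum>i\<in>UNIV. \<Sum>j\<in>UNIV. \<bar>A $ i $ j\<bar>) ^ n"
proof (induction n arbitrary: x y)
  case 0
  then show ?case by (simp add: mat_def)
next
  case (Suc n)
  let ?q = "\<Sum>i\<in>UNIV. \<Sum>j\<in>UNIV. \<bar>A $ i $ j\<bar>"
  let ?B = "((**) A ^^ n) (mat 1)"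
  have "\<bar>((**) A ^^ Suc n) (mat 1) $ x $ y\<bar> = \<bar>\<Sum>k\<in>UNIV. A $ x $ k * ?B $ k $ y\<bar>"
    by (simp add: matrix_matrix_mult_def)
  also have "\<dots> \<le> (\<Sum>k\<in>UNIV. \<bar>A $ x $ k\<bar> * ?q ^ n)"
    by (rule order_trans[OF sum_abs], rule sum_mono)
       (auto simp: abs_mult intro!: mult_left_mono Suc)
  also have "\<dots> = (\<Sum>k\<in>UNIV. \<bar>A $ x $ k\<bar>) * ?q ^ n"
    by (simp add: sum_distrib_right)
  also have "\<dots> \<le> ?q * ?q ^ n"
    by (intro mult_right_mono member_le_sum zero_le_power sum_nonneg) (auto intro: sum_nonneg)
  finally show ?case by simp
qed

lemma matrix_power_scaleR:
  fixes A :: "real ^ 'n ^ 'n"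
  shows "((**) (t *\<^sub>R A) ^^ n) (mat 1) = t ^ n *\<^sub>R ((**) A ^^ n) (mat 1)"
proof (induction n)
  case (Suc n)
  have "((**) (t *\<^sub>R A) ^^ Suc n) (mat 1) = (t *\<^sub>R A) ** (t ^ n *\<^sub>R ((**) A ^^ n) (mat 1))"
    by (simp only: funpow.simps o_apply Suc)
  also have "\<dots> = t ^ Suc n *\<^sub>R (A ** ((**) A ^^ n) (mat 1))"
    unfolding vec_eq_iff by (simp add: matrix_matrix_mult_def sum_distrib_left mult_ac)
  finally show ?case by simp
qed simp

text \<open>Entry by entry, the series is dominated by the exponential series of the sum of the absolute
  values of all entries of \<open>A\<close>, times \<open>|t|\<close>.\<close>
lemma summable_matrix_exp_entry:
  fixes A :: "real ^ 'n ^ 'n"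
  shows "summable (\<lambda>n. ((**) A ^^ n) (mat 1) $ x $ y / fact n * t ^ n)"
proof (rule summable_comparison_test')
  let ?q = "\<Sum>i\<in>UNIV. \<Sum>j\<in>UNIV. \<bar>A $ i $ j\<bar>"
  show "summable (\<lambda>n. inverse (fact n) * (?q * \<bar>t\<bar>) ^ n)"
    by (rule summable_exp)
  show "norm (((**) A ^^ n) (mat 1) $ x $ y / fact n * t ^ n) \<le> inverse (fact n) * (?q * \<bar>t\<bar>) ^ n"
    if "n \<ge> 0" for n
    using mult_right_mono[OF matrix_power_entry_bound[where A = A and n = n and x = x and y = y], of "\<bar>t\<bar> ^ n / fact n"]
    by (simp add: abs_mult power_abs power_mult_distrib field_simps)
qed

lemma matrix_exp_entry_sums:
  fixes A :: "real ^ 'n ^ 'n"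
  shows "(\<lambda>n. ((**) A ^^ n) (mat 1) $ x $ y / fact n * t ^ n) sums (matrix_exp (t *\<^sub>R A) $ x $ y)"
proof -
  define c where "c n = (((**) (t *\<^sub>R A) ^^ n) (mat 1)) /\<^sub>R fact n" for n
  have c: "c n $ i $ j = ((**) A ^^ n) (mat 1) $ i $ j / fact n * t ^ n" for n i j
    by (simp add: c_def matrix_power_scaleR divide_inverse mult_ac)
  have "c sums (\<chi> i j. \<Sum>n. c n $ i $ j)"
    unfolding sums_def
  proof (intro vec_tendstoI)
    fix i j
    have "(\<lambda>n. c n $ i $ j) sums (\<Sum>n. c n $ i $ j)"
      unfolding c by (intro summable_sums summable_matrix_exp_entry)
    then show "(\<lambda>n. (\<Sum>k<n. c k) $ i $ j) \<longlonglongrightarrow> (\<chi> i j. \<Sum>n. c n $ i $ j) $ i $ j"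
      by (simp add: sums_def)
  qed
  then have "matrix_exp (t *\<^sub>R A) $ x $ y = (\<Sum>n. c n $ x $ y)"
    unfolding matrix_exp_def c_def by (simp add: sums_unique[symmetric])
  then show ?thesis
    unfolding c using summable_sums[OF summable_matrix_exp_entry[where A = A and x = x and y = y and t = t]]
    by simp
qed

lemma matrix_exp_entry_derivative_0:
  fixes A :: "real ^ 'n ^ 'n"
  shows "((\<lambda>t. matrix_exp (t *\<^sub>R A) $ x $ y) has_real_derivative A $ x $ y) (at 0)"
proof -
  let ?c = "\<lambda>n. ((**) A ^^ n) (mat 1) $ x $ y / fact n"
  have "((\<lambda>t. \<Sum>n. ?c n * t ^ n) has_real_derivative (\<Sum>n. diffs ?c n * 0 ^ n)) (at 0)"
    by (rule termdiffs_strong_converges_everywhere[OF summable_matrix_exp_entry])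
  then show ?thesis
    unfolding matrix_exp_entry_sums[THEN sums_unique, symmetric] powser_zero
    by (simp add: diffs_def)
qed

text \<open>Every term of the series except the constant one starts with a factor \<open>Q\<close>, which \<open>\<pi>\<close>
  annihilates.\<close>
lemma invariant_distribution_matrix_exp:
  assumes "invariant_distribution Q \<pi>"
  shows "(\<Sum>x\<in>UNIV. pmf \<pi> x * matrix_exp (t *\<^sub>R Q) $ x $ y) = pmf \<pi> y"
proof -
  let ?c = "\<lambda>n x. ((**) Q ^^ n) (mat 1) $ x $ y / fact n * t ^ n"
  have "(\<lambda>n. \<Sum>x\<in>UNIV. pmf \<pi> x * ?c n x) sums
      (\<Sum>x\<in>UNIV. pmf \<pi> x * matrix_exp (t *\<^sub>R Q) $ x $ y)"
    by (intro sums_sum sums_mult matrix_exp_entry_sums)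
  moreover have "(\<Sum>x\<in>UNIV. pmf \<pi> x * ?c n x) = (if n = 0 then pmf \<pi> y else 0)" for n
  proof (cases n)
    case 0
    then show ?thesis by (simp add: mat_def if_distrib[of "(*) _"] if_distrib[of "\<lambda>c. c / _"] cong: if_cong)
  next
    case (Suc m)
    let ?B = "((**) Q ^^ m) (mat 1)"
    have "(\<Sum>x\<in>UNIV. pmf \<pi> x * ((**) Q ^^ n) (mat 1) $ x $ y)
        = (\<Sum>x\<in>UNIV. \<Sum>z\<in>UNIV. pmf \<pi> x * Q $ x $ z * ?B $ z $ y)"
      by (simp add: Suc matrix_matrix_mult_def sum_distrib_left mult_ac)
    also have "\<dots> = (\<Sum>z\<in>UNIV. (\<Sum>x\<in>UNIV. pmf \<pi> x * Q $ x $ z) * ?B $ z $ y)"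
      by (subst sum.swap) (simp add: sum_distrib_right)
    also have "\<dots> = 0"
      using assms by (simp add: invariant_distribution_def)
    finally have *: "(\<Sum>x\<in>UNIV. pmf \<pi> x * ((**) Q ^^ n) (mat 1) $ x $ y) = 0" .
    have "(\<Sum>x\<in>UNIV. pmf \<pi> x * ?c n x)
        = (\<Sum>x\<in>UNIV. pmf \<pi> x * ((**) Q ^^ n) (mat 1) $ x $ y) * (t ^ n / fact n)"
      unfolding sum_distrib_right by (rule sum.cong) simp_all
    then show ?thesis
      unfolding * using Suc by simp
  qed
  ultimately show ?thesis
    using sums_single[of 0 "\<lambda>_. pmf \<pi> y"] by (auto dest: sums_unique2)
qed

text \<open>A state charged by \<open>\<pi>\<close> reaches \<open>y\<close> within time \<open>1\<close> with positive probability, and \<open>\<pi>\<close> is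
  preserved over that time.\<close>
lemma (in markov_jump_process) invariant_distribution_pos:
  assumes "irreducible_process M X P" "rate_matrix M X P Q" "invariant_distribution Q \<pi>"
  shows "pmf \<pi> y > 0"
proof -
  have p: "matrix_exp (1 *\<^sub>R Q) $ x $ y > 0" for x
    using assms(1,2) unfolding irreducible_process_def rate_matrix_def
    by (metis zero_less_one less_imp_le)
  obtain z where z: "z \<in> set_pmf \<pi>"
    using set_pmf_not_empty[of \<pi>] by blast
  have "0 < pmf \<pi> z * matrix_exp (1 *\<^sub>R Q) $ z $ y"
    using z p by (simp add: pmf_positive)
  also have "\<dots> \<le> (\<Sum>x\<in>UNIV. pmf \<pi> x * matrix_exp (1 *\<^sub>R Q) $ x $ y)"
    by (rule member_le_sum) (use p in \<open>auto intro!: mult_nonneg_nonneg intro: less_imp_le\<close>)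
  also have "\<dots> = pmf \<pi> y"
    by (rule invariant_distribution_matrix_exp[OF assms(3)])
  finally show ?thesis .
qed

section \<open>The Markov property along a time grid\<close>

definition kernel_op :: "('e::finite \<Rightarrow> 'e \<Rightarrow> real) \<Rightarrow> ('e \<Rightarrow> real) \<Rightarrow> 'e \<Rightarrow> real" where
  "kernel_op K g x = (\<Sum>y\<in>UNIV. K x y * g y)"

context markov_jump_process
begin

lemma space_P: "space (P x) = space M"
  by (rule sets_eq_imp_space_eq[OF sets_P])

lemma measurable_X_P: "0 \<le> t \<Longrightarrow> X t \<in> measurable (P x) (count_space UNIV)"
  using measurable_X[of t] sets_P[of x] by (simp cong: measurable_cong_sets)

lemma integrable_P:
  assumes "h \<in> borel_measurable (P x)" "\<And>\<omega>. \<omega> \<in> space M \<Longrightarrow> \<bar>h \<omega>\<bar> \<le> B"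
  shows "integrable (P x) (h :: 'w \<Rightarrow> real)"
proof -
  interpret prob_space "P x" by (rule prob_space_P)
  show ?thesis
    by (rule integrable_const_bound[of _ B]) (use assms in \<open>auto simp: space_P\<close>)
qed

lemma space_natural_filtration: "space (natural_filtration M X s) = space M"
  unfolding natural_filtration_def by (subst space_measure_of) auto

lemma subalgebra_natural_filtration: "subalgebra (P x) (natural_filtration M X s)"
  unfolding subalgebra_def
proof
  show "sets (natural_filtration M X s) \<subseteq> sets (P x)"
    unfolding natural_filtration_def sets_P
    by (subst sets_measure_of) (auto intro!: sets.sigma_sets_subset measurable_sets[OF measurable_X])
qed (simp add: space_natural_filtration space_P)

lemma measurable_X_natural_filtration:
  assumes "0 \<le> u" "u \<le> s"
  shows "X u \<in> measurable (natural_filtration M X s) (count_space UNIV)"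
proof (rule measurableI)
  fix A :: "'e set"
  have "X u -` A \<inter> space M \<in> {X u -` A \<inter> space M | u A. 0 \<le> u \<and> u \<le> s}"
    using assms by blast
  then show "X u -` A \<inter> space (natural_filtration M X s) \<in> sets (natural_filtration M X s)"
    unfolding space_natural_filtration unfolding natural_filtration_def
    by (subst sets_measure_of) (blast intro: sigma_sets.Basic)+
qed simp

text \<open>Since the state space is finite, the Markov property for single states integrates to arbitrary
  functions \<open>g\<close> of the future state and bounded functionals \<open>Z\<close> of the past.\<close>
lemma markov_expectation:
  assumes "0 \<le> s" "0 \<le> t"
    and Z: "Z \<in> borel_measurable (natural_filtration M X s)" "\<And>\<omega>. \<omega> \<in> space M \<Longrightarrow> \<bar>Z \<omega>\<bar> \<le> B"
  shows "(\<integral>\<omega>. Z \<omega> * g (X (s + t) \<omega>) \<partial>P x)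
       = (\<integral>\<omega>. Z \<omega> * kernel_op (transition_prob M X P t) g (X s \<omega>) \<partial>P x)"
proof -
  interpret prob_space "P x" by (rule prob_space_P)
  interpret finite_measure_subalgebra "P x" "natural_filtration M X s"
    by unfold_locales (rule subalgebra_natural_filtration)
  have Zm [measurable]: "Z \<in> borel_measurable (P x)"
    using measurable_from_subalg[OF subalgebra_natural_filtration Z(1)] .
  have [measurable]: "X s \<in> measurable (P x) (count_space UNIV)"
      "X (s + t) \<in> measurable (P x) (count_space UNIV)"
    using assms by (auto intro!: measurable_X_P)
  let ?E = "\<lambda>y. {\<omega> \<in> space M. X (s + t) \<omega> = y}"
  have E [measurable]: "?E y \<in> sets (P x)" for y
    unfolding space_P[of x, symmetric] by measurable
  have B: "0 \<le> B" if "\<omega> \<in> space M" for \<omega>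
    using Z(2)[OF that] by simp
  have int1: "integrable (P x) (\<lambda>\<omega>. Z \<omega> * indicator (?E y) \<omega>)" for y
  proof (rule integrable_P[where B = B])
    show "\<bar>Z \<omega> * indicator (?E y) \<omega>\<bar> \<le> B" if "\<omega> \<in> space M" for \<omega>
      using Z(2)[OF that] B[OF that] by (auto simp: indicator_def)
  qed measurable
  have int2: "integrable (P x) (\<lambda>\<omega>. Z \<omega> * transition_prob M X P t (X s \<omega>) y)" for y
  proof (rule integrable_P[where B = "B * 1"])
    fix \<omega> assume \<omega>: "\<omega> \<in> space M"
    have "\<bar>transition_prob M X P t (X s \<omega>) y\<bar> \<le> 1"
      unfolding transition_prob_def using prob_space.prob_le_1[OF prob_space_P] by simp
    then show "\<bar>Z \<omega> * transition_prob M X P t (X s \<omega>) y\<bar> \<le> B * 1"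
      unfolding abs_mult using Z(2)[OF \<omega>] B[OF \<omega>] by (intro mult_mono) auto
  qed measurable
  have one: "(\<integral>\<omega>. Z \<omega> * indicator (?E y) \<omega> \<partial>P x)
      = (\<integral>\<omega>. Z \<omega> * transition_prob M X P t (X s \<omega>) y \<partial>P x)" for y
  proof -
    have "(\<integral>\<omega>. Z \<omega> * indicator (?E y) \<omega> \<partial>P x)
        = (\<integral>\<omega>. Z \<omega> * real_cond_exp (P x) (natural_filtration M X s) (indicator (?E y)) \<omega> \<partial>P x)"
      by (rule real_cond_exp_intg(2)[symmetric]) (use int1 Z in auto)
    also have "\<dots> = (\<integral>\<omega>. Z \<omega> * transition_prob M X P t (X s \<omega>) y \<partial>P x)"
      by (rule integral_cong_AE) (use markov[OF assms(1,2), of x y] in auto)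
    finally show ?thesis .
  qed
  have "(\<integral>\<omega>. Z \<omega> * g (X (s + t) \<omega>) \<partial>P x)
      = (\<integral>\<omega>. (\<Sum>y\<in>UNIV. (Z \<omega> * indicator (?E y) \<omega>) * g y) \<partial>P x)"
  proof (rule Bochner_Integration.integral_cong[OF refl])
    fix \<omega> assume "\<omega> \<in> space (P x)"
    then have "(\<Sum>y\<in>UNIV. (Z \<omega> * indicator (?E y) \<omega>) * g y)
        = (\<Sum>y\<in>UNIV. if X (s + t) \<omega> = y then Z \<omega> * g y else 0)"
      by (intro sum.cong) (auto simp: space_P)
    then show "Z \<omega> * g (X (s + t) \<omega>) = (\<Sum>y\<in>UNIV. (Z \<omega> * indicator (?E y) \<omega>) * g y)"
      by simp
  qed
  also have "\<dots> = (\<Sum>y\<in>UNIV. (\<integral>\<omega>. Z \<omega> * indicator (?E y) \<omega> \<partial>P x) * g y)"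
    using int1 by (subst Bochner_Integration.integral_sum) auto
  also have "\<dots> = (\<Sum>y\<in>UNIV. (\<integral>\<omega>. Z \<omega> * transition_prob M X P t (X s \<omega>) y \<partial>P x) * g y)"
    by (simp only: one)
  also have "\<dots> = (\<integral>\<omega>. (\<Sum>y\<in>UNIV. (Z \<omega> * transition_prob M X P t (X s \<omega>) y) * g y) \<partial>P x)"
    using int2 by (subst Bochner_Integration.integral_sum) auto
  also have "\<dots> = (\<integral>\<omega>. Z \<omega> * kernel_op (transition_prob M X P t) g (X s \<omega>) \<partial>P x)"
    by (simp add: kernel_op_def sum_distrib_left mult.assoc)
  finally show ?thesis .
qed

text \<open>Conditioning on the last but one grid time absorbs the last factor into \<open>g\<close>. The induction
  therefore has to run over all \<open>g\<close> at once.\<close>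
lemma expectation_product_along_grid:
  assumes "0 \<le> h"
  shows "(\<integral>\<omega>. (\<Prod>k<n. \<phi> (X (real (Suc k) * h) \<omega>)) * g (X (real n * h) \<omega>) \<partial>P x)
       = ((\<lambda>g. kernel_op (transition_prob M X P h) (\<lambda>y. \<phi> y * g y)) ^^ n) g x"
proof (induction n arbitrary: g)
  case 0
  interpret prob_space "P x" by (rule prob_space_P)
  have "AE \<omega> in P x. \<omega> \<in> {\<omega> \<in> space M. X 0 \<omega> = x}"
    using initial[of x] measurable_X_P[of 0 x]
    by (intro AE_prob_1) simp
  then have "(\<integral>\<omega>. g (X 0 \<omega>) \<partial>P x) = (\<integral>\<omega>. g x \<partial>P x)"
    by (intro integral_cong_AE) (auto intro!: measurable_compose[OF measurable_X_P])
  then show ?case by (simp add: prob_space)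
next
  case (Suc n)
  let ?T = "\<lambda>g. kernel_op (transition_prob M X P h) (\<lambda>y. \<phi> y * g y)"
  let ?Z = "\<lambda>\<omega>. \<Prod>k<n. \<phi> (X (real (Suc k) * h) \<omega>)"
  have "?Z \<in> borel_measurable (natural_filtration M X (real n * h))"
    using assms
    by (auto intro!: borel_measurable_prod measurable_compose[OF measurable_X_natural_filtration]
        mult_right_mono)
  moreover have "\<bar>?Z \<omega>\<bar> \<le> (\<Prod>k<n. Max (range (\<lambda>y. \<bar>\<phi> y\<bar>)))" for \<omega>
    unfolding abs_prod by (intro prod_mono) auto
  ultimately have "(\<integral>\<omega>. ?Z \<omega> * (\<phi> (X (real n * h + h) \<omega>) * g (X (real n * h + h) \<omega>)) \<partial>P x)
      = (\<integral>\<omega>. ?Z \<omega> * ?T g (X (real n * h) \<omega>) \<partial>P x)"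
    using assms by (intro markov_expectation[where g = "\<lambda>y. \<phi> y * g y"]) auto
  also have "\<dots> = (?T ^^ Suc n) g x"
    by (simp only: Suc funpow_Suc_right o_apply)
  finally show ?case
    by (simp add: algebra_simps)
qed

end

section \<open>Right Riemann sums\<close>

text \<open>Every cell of the grid is sampled at its right end point, which lies strictly to the right of
  all points of the half-open cell. As the mesh shrinks, the sample points thus approach each \<open>s\<close>
  from the right, where \<open>w\<close> converges; dominated convergence does the rest. The measurability of \<open>w\<close>
  on the interval comes out of the same approximation by step functions.\<close>
lemma right_riemann_sums_tendsto:
  fixes w :: "real \<Rightarrow> real"
  assumes "0 < t"
    and bound: "\<And>s. \<bar>w s\<bar> \<le> B"
    and right_cont: "\<And>s. 0 \<le> s \<Longrightarrow> (w \<longlongrightarrow> w s) (at_right s)"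
  shows "(\<lambda>n. (\<Sum>k<Suc n. w (real (Suc k) * (t / Suc n))) * (t / Suc n))
           \<longlonglongrightarrow> (LINT s:{0..t}|lborel. w s)"
proof -
  define h where "h n = t / Suc n" for n
  have h_pos: "0 < h n" for n using \<open>0 < t\<close> by (simp add: h_def)
  have h_lim: "h \<longlonglongrightarrow> 0"
    unfolding h_def by real_asymp
  define cell where "cell n k = {real k * h n ..< real (Suc k) * h n}" for n k
  define F where "F n s = (\<Sum>k<Suc n. w (real (Suc k) * h n) * indicator (cell n k) s)" for n s
  \<comment> \<open>The right end point of the cell that contains \<open>s\<close>.\<close>
  define next_point where "next_point n s = (of_int \<lfloor>s / h n\<rfloor> + 1) * h n" for n s
  have cell_iff: "s \<in> cell n k \<longleftrightarrow> \<lfloor>s / h n\<rfloor> = int k" for n k s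
    using h_pos[of n] by (simp add: cell_def floor_eq_iff field_simps)
  have F_inside: "F n s = w (next_point n s)" if s: "0 \<le> s" "s < t" for n s
  proof -
    define k where "k = nat \<lfloor>s / h n\<rfloor>"
    have fl: "\<lfloor>s / h n\<rfloor> = int k"
      using s h_pos[of n] by (simp add: k_def)
    have "s * Suc n < t * Suc n"
      using s by (intro mult_strict_right_mono) auto
    then have "s / h n < Suc n"
      using \<open>0 < t\<close> by (simp add: h_def divide_simps mult_ac)
    then have "k < Suc n"
      using fl by linarith
    have "F n s = (\<Sum>j<Suc n. if j = k then w (real (Suc j) * h n) else 0)"
      unfolding F_def by (rule sum.cong) (auto simp: indicator_def cell_iff fl)
    also have "\<dots> = w (real (Suc k) * h n)"
      using \<open>k < Suc n\<close> by (subst sum.delta) auto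
    also have "\<dots> = w (next_point n s)"
      by (simp add: next_point_def fl algebra_simps)
    finally show ?thesis .
  qed
  have F_outside: "F n s = 0" if s: "\<not> (0 \<le> s \<and> s < t)" for n s
  proof -
    have "s \<notin> cell n k" if "k < Suc n" for k
    proof
      assume sk: "s \<in> cell n k"
      have "real (Suc k) * h n \<le> real (Suc n) * h n"
        using that h_pos[of n] by (intro mult_right_mono) auto
      also have "\<dots> = t" by (simp add: h_def)
      finally have "s < t" using sk by (simp add: cell_def)
      moreover have "0 \<le> s"
        using sk h_pos[of n] by (auto simp: cell_def intro: order_trans[of 0 "real k * h n"])
      ultimately show False using s by simp
    qed
    then show ?thesis unfolding F_def by (intro sum.neutral) auto
  qed
  have next_gt: "s < next_point n s" "next_point n s \<le> s + h n" for n s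
  proof -
    have "s / h n < of_int \<lfloor>s / h n\<rfloor> + 1" "of_int \<lfloor>s / h n\<rfloor> \<le> s / h n" by linarith+
    then have "s < (of_int \<lfloor>s / h n\<rfloor> + 1) * h n" "of_int \<lfloor>s / h n\<rfloor> * h n \<le> s"
      using h_pos[of n] by (simp_all only: pos_divide_less_eq pos_le_divide_eq)
    then show "s < next_point n s" "next_point n s \<le> s + h n"
      by (simp_all add: next_point_def distrib_right)
  qed
  have next_lim: "filterlim (\<lambda>n. next_point n s) (at_right s) sequentially" for s
    unfolding filterlim_at
  proof
    show "\<forall>\<^sub>F n in sequentially. next_point n s \<in> {s<..} \<and> next_point n s \<noteq> s"
      using next_gt(1)[of s] by (intro always_eventually) (simp add: less_imp_neq[symmetric])
    show "(\<lambda>n. next_point n s) \<longlonglongrightarrow> s"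
    proof (rule tendsto_sandwich[where f = "\<lambda>_. s" and h = "\<lambda>n. s + h n"])
      show "(\<lambda>n. s + h n) \<longlonglongrightarrow> s"
        using tendsto_add[OF tendsto_const h_lim, of s] by simp
    qed (use next_gt in \<open>auto intro: less_imp_le always_eventually\<close>)
  qed
  have F_lim: "(\<lambda>n. F n s) \<longlonglongrightarrow> indicator {0..<t} s * w s" for s
  proof (cases "0 \<le> s \<and> s < t")
    case True
    then have "(\<lambda>n. w (next_point n s)) \<longlonglongrightarrow> w s"
      using filterlim_compose[OF right_cont next_lim] by simp
    with True show ?thesis by (simp add: F_inside)
  qed (simp add: F_outside)
  have F_meas [measurable]: "F n \<in> borel_measurable lborel" for n
    unfolding F_def cell_def by measurable
  \<comment> \<open>The half-open interval matters: at \<open>s = t\<close> all step functions vanish.\<close>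
  have lim_meas [measurable]: "(\<lambda>s. indicator {0..<t} s * w s) \<in> borel_measurable lborel"
    by (rule borel_measurable_LIMSEQ_real[OF F_lim F_meas])
  have B: "0 \<le> B" using bound[of 0] by simp
  have "(\<lambda>n. \<integral>s. F n s \<partial>lborel) \<longlonglongrightarrow> (\<integral>s. indicator {0..<t} s * w s \<partial>lborel)"
  proof (rule integral_dominated_convergence)
    show "integrable lborel (\<lambda>s. B * indicator {0..<t} s)"
      using \<open>0 < t\<close> by (intro integrable_mult_right integrable_real_indicator) auto
    show "AE s in lborel. norm (F n s) \<le> B * indicator {0..<t} s" for n
      by (rule AE_I2) (auto simp: F_inside F_outside bound indicator_def)
  qed (use F_lim in auto)
  moreover have "(\<integral>s. indicator {0..<t} s * w s \<partial>lborel) = (LINT s:{0..t}|lborel. w s)"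
  proof -
    have "(\<lambda>s. indicator {0..t} s * w s)
        = (\<lambda>s. indicator {0..<t} s * w s + w t * indicator {t} s)"
      using \<open>0 < t\<close> by (auto simp: indicator_def fun_eq_iff)
    then have [measurable]: "(\<lambda>s. indicator {0..t} s * w s) \<in> borel_measurable lborel"
      by simp
    show ?thesis
      unfolding set_lebesgue_integral_def real_scaleR_def
    proof (rule integral_cong_AE)
      show "AE s in lborel. indicator {0..<t} s * w s = indicator {0..t} s * w s"
        using AE_lborel_singleton[of t] by eventually_elim (auto simp: indicator_def)
    qed measurable
  qed
  moreover have "(\<integral>s. F n s \<partial>lborel) = (\<Sum>k<Suc n. w (real (Suc k) * h n)) * h n" for n
  proof -
    have "emeasure lborel (cell n k) = ennreal (h n)" for k
      using h_pos[of n] by (simp add: cell_def algebra_simps)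
    then have *: "measure lborel (cell n k) = h n" "emeasure lborel (cell n k) < \<infinity>" for k
      using h_pos[of n] by (auto simp: measure_def)
    have "cell n k \<in> sets lborel" for k by (simp add: cell_def)
    then have "(\<integral>s. F n s \<partial>lborel) = (\<Sum>k<Suc n. w (real (Suc k) * h n) * h n)"
      unfolding F_def using * by (subst Bochner_Integration.integral_sum) auto
    then show ?thesis by (simp only: sum_distrib_right)
  qed
  ultimately show ?thesis
    unfolding h_def by simp
qed

section \<open>The weighted inner product\<close>

lemma inner_L2_commute: "inner_L2 \<pi> g h = inner_L2 \<pi> h g"
  by (simp add: inner_L2_def mult_ac)

lemma inner_L2_add_left: "inner_L2 \<pi> (\<lambda>x. g1 x + g2 x) h = inner_L2 \<pi> g1 h + inner_L2 \<pi> g2 h"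
  by (simp add: inner_L2_def sum.distrib algebra_simps)

lemma inner_L2_scale_left: "inner_L2 \<pi> (\<lambda>x. s * g x) h = s * inner_L2 \<pi> g h"
  by (simp add: inner_L2_def sum_distrib_left mult_ac)

lemma inner_L2_add_right: "inner_L2 \<pi> g (\<lambda>x. h1 x + h2 x) = inner_L2 \<pi> g h1 + inner_L2 \<pi> g h2"
  by (simp add: inner_L2_def sum.distrib algebra_simps)

lemma inner_L2_scale_right: "inner_L2 \<pi> g (\<lambda>x. s * h x) = s * inner_L2 \<pi> g h"
  by (simp add: inner_L2_def sum_distrib_left mult_ac)

lemma inner_L2_nonneg: "0 \<le> inner_L2 \<pi> g g"
  by (simp add: inner_L2_def sum_nonneg)

lemma inner_L2_Cauchy_Schwarz: "inner_L2 \<pi> g h \<le> norm_L2 \<pi> g * norm_L2 \<pi> h"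
proof -
  have "(inner_L2 \<pi> g h)\<^sup>2
      = (\<Sum>x\<in>UNIV. (g x * sqrt (pmf \<pi> x)) * (h x * sqrt (pmf \<pi> x)))\<^sup>2"
    unfolding inner_L2_def
    by (intro arg_cong[where f = "\<lambda>c. c\<^sup>2"] sum.cong) (simp_all add: mult_ac mult.left_commute[of "sqrt _"])
  also have "\<dots> \<le> (\<Sum>x\<in>UNIV. (g x * sqrt (pmf \<pi> x))\<^sup>2) * (\<Sum>x\<in>UNIV. (h x * sqrt (pmf \<pi> x))\<^sup>2)"
    by (rule Cauchy_Schwarz_ineq_sum)
  also have "\<dots> = inner_L2 \<pi> g g * inner_L2 \<pi> h h"
    unfolding inner_L2_def
    by (intro arg_cong2[where f = "(*)"] sum.cong)
      (simp_all add: power_mult_distrib power2_eq_square[symmetric])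
  finally show ?thesis
    unfolding norm_L2_def by (metis real_sqrt_mult real_le_rsqrt)
qed

lemma generator_add: "generator Q (\<lambda>x. g x + h x) = (\<lambda>x. generator Q g x + generator Q h x)"
  by (simp add: generator_def fun_eq_iff sum.distrib algebra_simps)

lemma generator_scale: "generator Q (\<lambda>x. s * g x) = (\<lambda>x. s * generator Q g x)"
  by (simp add: generator_def fun_eq_iff sum_distrib_left mult_ac)

lemma expectation_pmf_finite:
  "measure_pmf.expectation \<beta> (f :: 'e::finite \<Rightarrow> real) = (\<Sum>x\<in>UNIV. pmf \<beta> x * f x)"
  by (subst integral_measure_pmf[of UNIV]) auto

lemma pmf_of_weights:
  fixes p :: "'e::finite \<Rightarrow> real"
  assumes "\<And>x. 0 \<le> p x" "(\<Sum>x\<in>UNIV. p x) = 1"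
  obtains \<beta> where "pmf \<beta> = p"
proof -
  have "(\<integral>\<^sup>+x. ennreal (p x) \<partial>count_space UNIV) = 1"
    using assms by (simp add: nn_integral_count_space_finite sum_ennreal)
  then have "pmf (embed_pmf p) = p"
    by (simp add: fun_eq_iff pmf_embed_pmf assms(1))
  then show ?thesis by (rule that)
qed

text \<open>The first-order condition at a minimum, for a quadratic polynomial in \<open>s\<close>.\<close>
lemma linear_term_zero:
  fixes a d :: real
  assumes "\<And>s. 0 \<le> 2 * s * a + s\<^sup>2 * d" "0 \<le> d"
  shows "a = 0"
proof (rule ccontr)
  assume "a \<noteq> 0"
  define s where "s = - a / (d + 1)"
  have "2 * s * a + s\<^sup>2 * d = - (a\<^sup>2 * (d + 2)) / (d + 1)\<^sup>2"
    using \<open>0 \<le> d\<close> by (simp add: s_def divide_simps power2_eq_square) (simp add: algebra_simps)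
  also have "\<dots> < 0"
    using \<open>0 \<le> d\<close> \<open>a \<noteq> 0\<close> by (simp add: divide_neg_pos)
  finally show False using assms(1)[of s] by simp
qed

section \<open>The Dirichlet form and the Donsker--Varadhan information\<close>

text \<open>The analytic part of the argument uses the process only through its rate matrix and an
  everywhere positive stationary distribution.\<close>
locale stationary_generator =
  fixes Q :: "real ^ 'e ^ 'e" and \<pi> :: "'e::finite pmf"
  assumes rate_nonneg: "x \<noteq> y \<Longrightarrow> 0 \<le> Q $ x $ y"
    and row_sum: "(\<Sum>y\<in>UNIV. Q $ x $ y) = 0"
    and stationary: "(\<Sum>x\<in>UNIV. pmf \<pi> x * Q $ x $ y) = 0"
    and weight_pos: "0 < pmf \<pi> x"
begin

lemma weight_neq_0: "pmf \<pi> x \<noteq> 0"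
  using weight_pos[of x] by simp

lemma inner_L2_zero_iff: "inner_L2 \<pi> g g = 0 \<longleftrightarrow> g = (\<lambda>x. 0)"
  unfolding inner_L2_def
  by (subst sum_nonneg_eq_0_iff) (auto simp: fun_eq_iff weight_neq_0)

text \<open>The Dirichlet form \<open>-\<langle>Lg, g\<rangle>\<close>.\<close>
definition energy :: "('e \<Rightarrow> real) \<Rightarrow> real" where
  "energy g = - inner_L2 \<pi> (generator Q g) g"

lemma energy_eq_sum:
  "energy g = - (\<Sum>x\<in>UNIV. \<Sum>y\<in>UNIV. pmf \<pi> x * Q $ x $ y * (g x * g y))"
  by (simp add: energy_def inner_L2_def generator_def sum_distrib_left mult_ac)

text \<open>Expanding the square leaves only the mixed terms: the terms in \<open>(g x)\<^sup>2\<close> cancel because the rows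
  of \<open>Q\<close> sum to zero, those in \<open>(g y)\<^sup>2\<close> because \<open>\<pi>\<close> is stationary. The diagonal rates are now multiplied
  by \<open>0\<close>, so all weights that count are nonnegative; nonnegativity of the energy and its behaviour
  under \<open>|g|\<close> can be read off.\<close>
lemma energy_eq_squares:
  "energy g = (\<Sum>x\<in>UNIV. \<Sum>y\<in>UNIV. pmf \<pi> x * Q $ x $ y * (g x - g y)\<^sup>2) / 2"
proof -
  have 1: "(\<Sum>x\<in>UNIV. \<Sum>y\<in>UNIV. pmf \<pi> x * Q $ x $ y * (g x)\<^sup>2) = 0"
  proof -
    have "(\<Sum>x\<in>UNIV. \<Sum>y\<in>UNIV. pmf \<pi> x * Q $ x $ y * (g x)\<^sup>2)
        = (\<Sum>x\<in>UNIV. pmf \<pi> x * (g x)\<^sup>2 * (\<Sum>y\<in>UNIV. Q $ x $ y))"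
      by (simp add: sum_distrib_left sum_distrib_right mult_ac)
    then show ?thesis by (simp add: row_sum)
  qed
  have 2: "(\<Sum>x\<in>UNIV. \<Sum>y\<in>UNIV. pmf \<pi> x * Q $ x $ y * (g y)\<^sup>2) = 0"
  proof -
    have "(\<Sum>x\<in>UNIV. \<Sum>y\<in>UNIV. pmf \<pi> x * Q $ x $ y * (g y)\<^sup>2)
        = (\<Sum>y\<in>UNIV. (\<Sum>x\<in>UNIV. pmf \<pi> x * Q $ x $ y) * (g y)\<^sup>2)"
      by (subst sum.swap) (simp add: sum_distrib_right)
    then show ?thesis by (simp add: stationary)
  qed
  have "(\<Sum>x\<in>UNIV. \<Sum>y\<in>UNIV. pmf \<pi> x * Q $ x $ y * (g x - g y)\<^sup>2)
      = (\<Sum>x\<in>UNIV. \<Sum>y\<in>UNIV. pmf \<pi> x * Q $ x $ y * (g x)\<^sup>2)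
      + (\<Sum>x\<in>UNIV. \<Sum>y\<in>UNIV. pmf \<pi> x * Q $ x $ y * (g y)\<^sup>2)
      - 2 * (\<Sum>x\<in>UNIV. \<Sum>y\<in>UNIV. pmf \<pi> x * Q $ x $ y * (g x * g y))"
    by (simp add: power2_diff sum.distrib sum_subtractf sum_distrib_left algebra_simps)
  then show ?thesis
    unfolding 1 2 energy_eq_sum by simp
qed

lemma rate_square_mono:
  assumes "\<bar>a x - a y\<bar> \<le> \<bar>b x - b y\<bar>"
  shows "pmf \<pi> x * Q $ x $ y * (a x - a y)\<^sup>2 \<le> pmf \<pi> x * Q $ x $ y * (b x - b y)\<^sup>2"
proof (cases "x = y")
  case False
  then show ?thesis
    using assms by (intro mult_left_mono abs_le_square_iff[THEN iffD1] mult_nonneg_nonneg)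
      (auto intro: rate_nonneg)
qed simp

lemma energy_nonneg: "0 \<le> energy g"
proof -
  have "0 \<le> pmf \<pi> x * Q $ x $ y * (g x - g y)\<^sup>2" for x y
    using rate_square_mono[of "\<lambda>_. 0" x y g] by simp
  then show ?thesis
    unfolding energy_eq_squares by (simp add: sum_nonneg)
qed

lemma energy_abs_le: "energy (\<lambda>x. \<bar>g x\<bar>) \<le> energy g"
  unfolding energy_eq_squares
  by (intro divide_right_mono sum_mono rate_square_mono abs_triangle_ineq3) simp

lemma energy_scale: "energy (\<lambda>x. s * g x) = s\<^sup>2 * energy g"
  by (simp add: energy_def generator_scale inner_L2_scale_left inner_L2_scale_right power2_eq_square)

lemma DV_information_eq: "DV_information Q \<pi> \<beta> = energy (\<lambda>x. sqrt (pmf \<beta> x / pmf \<pi> x))"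
  by (simp add: DV_information_def energy_def pmf_density_def)

lemma DV_information_nonneg: "0 \<le> DV_information Q \<pi> \<beta>"
  by (simp add: DV_information_eq energy_nonneg)

lemma DV_information_stationary: "DV_information Q \<pi> \<pi> = 0"
  by (simp add: DV_information_eq energy_eq_squares weight_neq_0)

text \<open>The measure with density \<open>g\<^sup>2\<close>, normalised, has information at most the normalised energy of
  \<open>g\<close>, since the square root of its density is a multiple of \<open>|g|\<close>.\<close>
lemma form_le_if_variational_le:
  assumes "\<And>\<beta>. r * measure_pmf.expectation \<beta> f - DV_information Q \<pi> \<beta> \<le> c"
  shows "r * inner_L2 \<pi> (\<lambda>x. f x * g x) g - energy g \<le> c * inner_L2 \<pi> g g"
proof (cases "inner_L2 \<pi> g g = 0")
  case True
  then have "g = (\<lambda>x. 0)" by (simp only: inner_L2_zero_iff)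
  then show ?thesis by (simp add: inner_L2_def energy_def)
next
  case False
  define N where "N = inner_L2 \<pi> g g"
  have N: "0 < N"
    using False inner_L2_nonneg[of \<pi> g] unfolding N_def by linarith
  obtain \<beta> where \<beta>: "pmf \<beta> = (\<lambda>x. (g x)\<^sup>2 * pmf \<pi> x / N)"
  proof (rule pmf_of_weights)
    show "(\<Sum>x\<in>UNIV. (g x)\<^sup>2 * pmf \<pi> x / N) = 1"
      using N by (simp add: sum_divide_distrib[symmetric] N_def inner_L2_def power2_eq_square)
  qed (use N in auto)
  have "sqrt (pmf \<beta> x / pmf \<pi> x) = 1 / sqrt N * \<bar>g x\<bar>" for x
    using weight_pos[of x] by (simp add: \<beta> real_sqrt_divide)
  then have "DV_information Q \<pi> \<beta> = energy (\<lambda>x. 1 / sqrt N * \<bar>g x\<bar>)"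
    by (simp only: DV_information_eq)
  also have "\<dots> = energy (\<lambda>x. \<bar>g x\<bar>) / N"
    using N by (simp only: energy_scale) (simp add: power_divide)
  also have "\<dots> \<le> energy g / N"
    using N by (intro divide_right_mono energy_abs_le) auto
  finally have "DV_information Q \<pi> \<beta> \<le> energy g / N" .
  moreover have "measure_pmf.expectation \<beta> f = inner_L2 \<pi> (\<lambda>x. f x * g x) g / N"
    by (simp add: expectation_pmf_finite \<beta> inner_L2_def sum_divide_distrib power2_eq_square mult_ac)
  ultimately have "r * (inner_L2 \<pi> (\<lambda>x. f x * g x) g / N) - energy g / N \<le> c"
    using assms[of \<beta>] by simp
  then show ?thesis
    using N unfolding N_def[symmetric] by (simp add: field_simps)
qed

end

section \<open>Compactness and convexity of the information\<close>

context stationary_generator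
begin

text \<open>The information as a function on Euclidean space, where compactness and separation theorems are
  at hand.\<close>
definition vec_information :: "real ^ 'e \<Rightarrow> real" where
  "vec_information p = energy (\<lambda>x. sqrt (p $ x / pmf \<pi> x))"

lemma continuous_vec_information: "continuous_on A vec_information"
  unfolding vec_information_def energy_eq_sum
  by (intro continuous_intros) (auto simp: weight_neq_0)

end

definition prob_simplex :: "(real ^ 'e::finite) set" where
  "prob_simplex = {p. (\<forall>x. 0 \<le> p $ x) \<and> (\<Sum>x\<in>UNIV. p $ x) = 1}"

lemma prob_simplex_iff: "p \<in> prob_simplex \<longleftrightarrow> (\<exists>\<beta>. p = (\<chi> x. pmf \<beta> x))"
proof
  assume "p \<in> prob_simplex"
  then obtain \<beta> where "pmf \<beta> = (\<lambda>x. p $ x)"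
    using pmf_of_weights[of "\<lambda>x. p $ x"] unfolding prob_simplex_def by blast
  then have "p = (\<chi> x. pmf \<beta> x)" by (simp add: vec_eq_iff)
  then show "\<exists>\<beta>. p = (\<chi> x. pmf \<beta> x)" ..
qed (auto simp: prob_simplex_def sum_pmf_eq_1)

lemma compact_prob_simplex: "compact prob_simplex"
proof -
  have "closed (prob_simplex :: (real ^ 'e) set)"
    unfolding prob_simplex_def
    by (intro closed_Collect_conj closed_Collect_all closed_Collect_le closed_Collect_eq continuous_intros)
  moreover have "bounded (prob_simplex :: (real ^ 'e) set)"
  proof (rule boundedI)
    fix p :: "real ^ 'e" assume "p \<in> prob_simplex"
    then show "norm p \<le> 1"
      using norm_le_l1_cart[of p] by (simp add: prob_simplex_def)
  qed
  ultimately show ?thesis by (simp add: compact_eq_bounded_closed)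
qed

lemma convex_prob_simplex: "convex prob_simplex"
proof (rule convexI)
  fix p q :: "real ^ 'e" and u v :: real
  assume *: "p \<in> prob_simplex" "q \<in> prob_simplex" "0 \<le> u" "0 \<le> v" "u + v = 1"
  have "(\<Sum>x\<in>UNIV. (u *\<^sub>R p + v *\<^sub>R q) $ x) = u * (\<Sum>x\<in>UNIV. p $ x) + v * (\<Sum>x\<in>UNIV. q $ x)"
    by (simp add: sum.distrib sum_distrib_left)
  then show "u *\<^sub>R p + v *\<^sub>R q \<in> prob_simplex"
    using * by (auto simp: prob_simplex_def)
qed

context stationary_generator
begin

lemma exists_optimal_measure:
  obtains \<beta>' where "\<And>\<beta>. r * measure_pmf.expectation \<beta> f - DV_information Q \<pi> \<beta>
      \<le> r * measure_pmf.expectation \<beta>' f - DV_information Q \<pi> \<beta>'"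
proof -
  let ?J = "\<lambda>p :: real ^ 'e. r * (\<Sum>x\<in>UNIV. p $ x * f x) - vec_information p"
  have "continuous_on prob_simplex ?J"
    by (intro continuous_intros continuous_vec_information)
  moreover have "(prob_simplex :: (real ^ 'e) set) \<noteq> {}"
    using prob_simplex_iff by blast
  ultimately obtain p where p: "p \<in> prob_simplex" "\<forall>q\<in>prob_simplex. ?J q \<le> ?J p"
    using continuous_attains_sup[OF compact_prob_simplex] by blast
  then obtain \<beta>' where "p = (\<chi> x. pmf \<beta>' x)"
    using prob_simplex_iff by blast
  have J: "?J (\<chi> x. pmf \<beta> x) = r * measure_pmf.expectation \<beta> f - DV_information Q \<pi> \<beta>" for \<beta>
    by (simp add: expectation_pmf_finite vec_information_def DV_information_eq)
  show ?thesis
  proof (rule that)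
    fix \<beta>
    have "?J (\<chi> x. pmf \<beta> x) \<le> ?J (\<chi> x. pmf \<beta>' x)"
      using p(2) prob_simplex_iff \<open>p = _\<close> by blast
    then show "r * measure_pmf.expectation \<beta> f - DV_information Q \<pi> \<beta>
      \<le> r * measure_pmf.expectation \<beta>' f - DV_information Q \<pi> \<beta>'"
      unfolding J .
  qed
qed

text \<open>Off the diagonal the rates are nonnegative and enter with a negative sign, while the geometric
  mean \<open>sqrt a * sqrt b\<close> is concave; on the diagonal the expression is linear in \<open>p\<close>.\<close>
lemma vec_information_convex:
  assumes "p \<in> prob_simplex" "q \<in> prob_simplex" and uv: "0 \<le> u" "0 \<le> v" "u + v = 1"
  shows "vec_information (u *\<^sub>R p + v *\<^sub>R q) \<le> u * vec_information p + v * vec_information q"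
proof -
  have sqrt_concave: "u * (sqrt a * sqrt b) + v * (sqrt c * sqrt d)
      \<le> sqrt (u * a + v * c) * sqrt (u * b + v * d)"
    if "0 \<le> a" "0 \<le> b" "0 \<le> c" "0 \<le> d" for a b c d :: real
  proof -
    have "(u * (sqrt a * sqrt b) + v * (sqrt c * sqrt d))\<^sup>2
        \<le> (u * a + v * c) * (u * b + v * d)"
    proof -
      have "(u * A\<^sup>2 + v * C\<^sup>2) * (u * B\<^sup>2 + v * D\<^sup>2) - (u * (A * B) + v * (C * D))\<^sup>2
          = u * v * (A * D - B * C)\<^sup>2" for A B C D :: real
        by algebra
      from this[of "sqrt a" "sqrt c" "sqrt b" "sqrt d"]
      have "(u * a + v * c) * (u * b + v * d) - (u * (sqrt a * sqrt b) + v * (sqrt c * sqrt d))\<^sup>2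
          = u * v * (sqrt a * sqrt d - sqrt b * sqrt c)\<^sup>2"
        using that by simp
      moreover have "0 \<le> u * v * (sqrt a * sqrt d - sqrt b * sqrt c)\<^sup>2" using uv by simp
      ultimately show ?thesis by linarith
    qed
    then show ?thesis
      by (metis real_le_rsqrt real_sqrt_mult)
  qed
  let ?s = "\<lambda>w :: real ^ 'e. \<lambda>x. sqrt (w $ x / pmf \<pi> x)"
  let ?m = "u *\<^sub>R p + v *\<^sub>R q"
  have nonneg: "0 \<le> p $ x / pmf \<pi> x" "0 \<le> q $ x / pmf \<pi> x" for x
    using assms(1,2) by (auto simp: prob_simplex_def)
  have m: "?m $ x / pmf \<pi> x = u * (p $ x / pmf \<pi> x) + v * (q $ x / pmf \<pi> x)" for x
    by (simp add: add_divide_distrib)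
  have "pmf \<pi> x * Q $ x $ y * (u * (?s p x * ?s p y) + v * (?s q x * ?s q y))
      \<le> pmf \<pi> x * Q $ x $ y * (?s ?m x * ?s ?m y)" for x y
  proof (cases "x = y")
    case True
    have "?s ?m x * ?s ?m x = u * (p $ x / pmf \<pi> x) + v * (q $ x / pmf \<pi> x)"
      unfolding m using nonneg[of x] uv
      by (subst real_sqrt_mult_self, intro abs_of_nonneg add_nonneg_nonneg mult_nonneg_nonneg)
    moreover have "?s p x * ?s p x = p $ x / pmf \<pi> x" "?s q x * ?s q x = q $ x / pmf \<pi> x"
      using nonneg[of x] by (simp_all only: real_sqrt_mult_self abs_of_nonneg)
    ultimately show ?thesis
      unfolding \<open>x = y\<close>[symmetric] by (simp only: order_refl)
  next
    case False
    then show ?thesis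
      using sqrt_concave[OF nonneg(1) nonneg(1) nonneg(2) nonneg(2), of x y x y] unfolding m
      by (intro mult_left_mono mult_nonneg_nonneg) (auto intro: rate_nonneg)
  qed
  then have "(\<Sum>x\<in>UNIV. \<Sum>y\<in>UNIV. pmf \<pi> x * Q $ x $ y * (u * (?s p x * ?s p y) + v * (?s q x * ?s q y)))
      \<le> (\<Sum>x\<in>UNIV. \<Sum>y\<in>UNIV. pmf \<pi> x * Q $ x $ y * (?s ?m x * ?s ?m y))"
    by (intro sum_mono)
  also have "(\<Sum>x\<in>UNIV. \<Sum>y\<in>UNIV. pmf \<pi> x * Q $ x $ y * (u * (?s p x * ?s p y) + v * (?s q x * ?s q y)))
      = u * (\<Sum>x\<in>UNIV. \<Sum>y\<in>UNIV. pmf \<pi> x * Q $ x $ y * (?s p x * ?s p y))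
      + v * (\<Sum>x\<in>UNIV. \<Sum>y\<in>UNIV. pmf \<pi> x * Q $ x $ y * (?s q x * ?s q y))"
    unfolding sum_distrib_left sum.distrib[symmetric]
    by (intro sum.cong refl) (simp only: distrib_left mult.left_commute)
  finally show ?thesis
    unfolding vec_information_def energy_eq_sum by simp
qed

end

section \<open>The largest eigenvalue as a variational maximum\<close>

context stationary_generator
begin

text \<open>The choice in the definition of the adjoint is well-founded: the time-reversed rates
  \<open>\<pi> y * Q $ y $ x / \<pi> x\<close> define an adjoint.\<close>
lemma inner_adjoint_L2:
  "inner_L2 \<pi> (generator Q g) h = inner_L2 \<pi> g (adjoint_L2 \<pi> (generator Q) h)"
proof -
  define S where "S h x = (\<Sum>y\<in>UNIV. pmf \<pi> y * Q $ y $ x * h y) / pmf \<pi> x" for h x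
  have "inner_L2 \<pi> (generator Q g) h = inner_L2 \<pi> g (S h)" for g h
  proof -
    have "inner_L2 \<pi> (generator Q g) h
        = (\<Sum>y\<in>UNIV. \<Sum>x\<in>UNIV. g x * (pmf \<pi> y * Q $ y $ x * h y))"
      by (simp add: inner_L2_def generator_def sum_distrib_left sum_distrib_right mult_ac)
    also have "\<dots> = (\<Sum>x\<in>UNIV. g x * (\<Sum>y\<in>UNIV. pmf \<pi> y * Q $ y $ x * h y))"
      by (subst sum.swap) (simp add: sum_distrib_left)
    also have "\<dots> = inner_L2 \<pi> g (S h)"
      by (simp add: inner_L2_def S_def weight_neq_0)
    finally show ?thesis .
  qed
  then have "\<forall>g h. inner_L2 \<pi> (generator Q g) h = inner_L2 \<pi> g (S h)" by blast
  then have "\<forall>g h. inner_L2 \<pi> (generator Q g) h = inner_L2 \<pi> g (adjoint_L2 \<pi> (generator Q) h)"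
    unfolding adjoint_L2_def
    by (rule someI[where P = "\<lambda>S. \<forall>g h. inner_L2 \<pi> (generator Q g) h = inner_L2 \<pi> g (S h)"])
  then show ?thesis by blast
qed

text \<open>The symmetric bilinear form of the tilted operator, written without the adjoint so that its
  bilinearity is immediate.\<close>
definition form :: "('e \<Rightarrow> real) \<Rightarrow> real \<Rightarrow> ('e \<Rightarrow> real) \<Rightarrow> ('e \<Rightarrow> real) \<Rightarrow> real" where
  "form f r g h = (inner_L2 \<pi> (generator Q g) h + inner_L2 \<pi> (generator Q h) g) / 2
     + r * inner_L2 \<pi> (\<lambda>x. f x * g x) h"

lemma inner_tilted_operator: "inner_L2 \<pi> (tilted_operator Q \<pi> f r g) h = form f r g h"
proof -
  have "tilted_operator Q \<pi> f r g = (\<lambda>x. 1 / 2 * (generator Q g x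
      + adjoint_L2 \<pi> (generator Q) g x) + r * (f x * g x))"
    by (simp add: fun_eq_iff tilted_operator_def)
  then have "inner_L2 \<pi> (tilted_operator Q \<pi> f r g) h
      = 1 / 2 * (inner_L2 \<pi> (generator Q g) h + inner_L2 \<pi> (adjoint_L2 \<pi> (generator Q) g) h)
        + r * inner_L2 \<pi> (\<lambda>x. f x * g x) h"
    by (simp only: inner_L2_add_left inner_L2_scale_left)
  then show ?thesis
    by (simp add: form_def inner_L2_commute[of \<pi> "adjoint_L2 _ _ _"] inner_adjoint_L2[symmetric])
qed

lemma form_self: "form f r g g = r * inner_L2 \<pi> (\<lambda>x. f x * g x) g - energy g"
  by (simp add: form_def energy_def)

lemma form_add_scale:
  "form f r (\<lambda>x. g x + s * h x) (\<lambda>x. g x + s * h x)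
    = form f r g g + 2 * s * form f r g h + s\<^sup>2 * form f r h h"
proof -
  have "inner_L2 \<pi> (\<lambda>x. f x * h x) g = inner_L2 \<pi> (\<lambda>x. f x * g x) h"
    by (simp add: inner_L2_def mult_ac)
  moreover have "(\<lambda>x. f x * (g x + s * h x)) = (\<lambda>x. f x * g x + s * (f x * h x))"
    by (simp add: fun_eq_iff algebra_simps)
  ultimately show ?thesis
    unfolding form_def generator_add generator_scale
    by (simp only: inner_L2_add_left inner_L2_add_right inner_L2_scale_left inner_L2_scale_right
        generator_add generator_scale) (simp add: field_simps power2_eq_square)
qed

text \<open>The square root \<open>g\<close> of the optimal density maximises the quadratic form relative to the squared
  norm. Varying \<open>g\<close> in every direction \<open>h\<close> shows that it is an eigenvector for the maximal value \<open>c\<close>;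
  pairing any eigenvector with itself shows that no eigenvalue exceeds \<open>c\<close>.\<close>
lemma lambda0_variational:
  assumes opt: "\<And>\<beta>. r * measure_pmf.expectation \<beta> f - DV_information Q \<pi> \<beta>
      \<le> r * measure_pmf.expectation \<beta>' f - DV_information Q \<pi> \<beta>'"
  shows "lambda0 Q \<pi> f r = r * measure_pmf.expectation \<beta>' f - DV_information Q \<pi> \<beta>'"
proof -
  define c where "c = r * measure_pmf.expectation \<beta>' f - DV_information Q \<pi> \<beta>'"
  have form_le: "form f r g g \<le> c * inner_L2 \<pi> g g" for g
    unfolding form_self c_def using opt by (rule form_le_if_variational_le)
  define g where "g x = sqrt (pmf \<beta>' x / pmf \<pi> x)" for x
  have norm_g: "inner_L2 \<pi> g g = 1"
    by (simp add: inner_L2_def g_def weight_neq_0 sum_pmf_eq_1)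
  have g_square: "g x * g x = pmf \<beta>' x / pmf \<pi> x" for x
    by (simp add: g_def)
  have "inner_L2 \<pi> (\<lambda>x. f x * g x) g = (\<Sum>x\<in>UNIV. f x * (g x * g x) * pmf \<pi> x)"
    by (simp add: inner_L2_def mult.assoc)
  also have "\<dots> = measure_pmf.expectation \<beta>' f"
    unfolding g_square by (simp add: expectation_pmf_finite weight_neq_0 mult.commute)
  finally have "inner_L2 \<pi> (\<lambda>x. f x * g x) g = measure_pmf.expectation \<beta>' f" .
  then have form_g: "form f r g g = c"
    by (simp add: form_self c_def DV_information_eq g_def[abs_def])
  have stationary_point: "c * inner_L2 \<pi> g h - form f r g h = 0" for h
  proof (rule linear_term_zero)
    fix s
    show "0 \<le> 2 * s * (c * inner_L2 \<pi> g h - form f r g h)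
        + s\<^sup>2 * (c * inner_L2 \<pi> h h - form f r h h)"
      using form_le[of "\<lambda>x. g x + s * h x"]
      unfolding form_add_scale form_g
      by (simp add: inner_L2_add_left inner_L2_add_right inner_L2_scale_left inner_L2_scale_right
          inner_L2_commute[of \<pi> h g] norm_g power2_eq_square algebra_simps)
  qed (use form_le[of h] in simp)
  have eigen: "operator_eigenvalue (tilted_operator Q \<pi> f r) c"
    unfolding operator_eigenvalue_def
  proof (intro exI conjI)
    show "g \<noteq> (\<lambda>x. 0)" using norm_g by (auto simp: inner_L2_def)
    let ?h = "\<lambda>x. c * g x + (-1) * tilted_operator Q \<pi> f r g x"
    have "inner_L2 \<pi> ?h ?h = c * inner_L2 \<pi> g ?h - form f r g ?h"
      by (simp only: inner_L2_add_left inner_L2_scale_left inner_tilted_operator)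
    then have "?h = (\<lambda>x. 0)"
      using stationary_point inner_L2_zero_iff by metis
    then show "tilted_operator Q \<pi> f r g = (\<lambda>x. c * g x)"
      by (simp add: fun_eq_iff)
  qed
  have "c' \<le> c" if c': "operator_eigenvalue (tilted_operator Q \<pi> f r) c'" for c'
  proof -
    obtain h where h: "h \<noteq> (\<lambda>x. 0)" "tilted_operator Q \<pi> f r h = (\<lambda>x. c' * h x)"
      using c' unfolding operator_eigenvalue_def by blast
    have "c' * inner_L2 \<pi> h h = form f r h h"
      unfolding inner_tilted_operator[symmetric] h(2) by (simp add: inner_L2_scale_left)
    also have "\<dots> \<le> c * inner_L2 \<pi> h h"
      by (rule form_le)
    finally have "c' * inner_L2 \<pi> h h \<le> c * inner_L2 \<pi> h h" .
    moreover have "0 < inner_L2 \<pi> h h"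
      using h(1) inner_L2_nonneg[of \<pi> h] inner_L2_zero_iff[of h] by linarith
    ultimately show ?thesis by simp
  qed
  then show ?thesis
    unfolding lambda0_def c_def[symmetric] by (intro Greatest_equality eigen)
qed

end

section \<open>Tangents to the information function\<close>

context stationary_generator
begin

text \<open>The set is the sum of a compact set, the image of the simplex, and a closed vertical ray.
  Closedness is what makes the duality below hold also at the largest possible mean, since
  the lower boundary of the region could otherwise jump there.\<close>
lemma closed_information_epigraph:
  "closed {(\<Sum>x\<in>UNIV. p $ x * f x, vec_information p + s) | p s. p \<in> prob_simplex \<and> 0 \<le> s}"
proof -
  let ?\<Phi> = "\<lambda>p :: real ^ 'e. (\<Sum>x\<in>UNIV. p $ x * f x, vec_information p)"
  have "compact (?\<Phi> ` prob_simplex)"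
    by (intro compact_continuous_image compact_prob_simplex continuous_intros continuous_vec_information)
  moreover have "closed ({0 :: real} \<times> {0 :: real..})"
    by (intro closed_Times) auto
  ultimately have "closed (\<Union>a\<in>?\<Phi> ` prob_simplex. \<Union>b\<in>{0 :: real} \<times> {0 :: real..}. {a + b})"
    by (rule compact_closed_sums)
  also have "(\<Union>a\<in>?\<Phi> ` prob_simplex. \<Union>b\<in>{0 :: real} \<times> {0 :: real..}. {a + b})
      = {(\<Sum>x\<in>UNIV. p $ x * f x, vec_information p + s) | p s. p \<in> prob_simplex \<and> 0 \<le> s}"
    by fastforce
  finally show ?thesis .
qed

lemma convex_information_epigraph:
  "convex {(\<Sum>x\<in>UNIV. p $ x * f x, vec_information p + s) | p s. p \<in> prob_simplex \<and> 0 \<le> s}"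
proof (rule convexI)
  fix a b :: "real \<times> real" and u v :: real
  assume uv: "0 \<le> u" "0 \<le> v" "u + v = 1"
  assume "a \<in> {(\<Sum>x\<in>UNIV. p $ x * f x, vec_information p + s) | p s. p \<in> prob_simplex \<and> 0 \<le> s}"
    and "b \<in> {(\<Sum>x\<in>UNIV. p $ x * f x, vec_information p + s) | p s. p \<in> prob_simplex \<and> 0 \<le> s}"
  then obtain p s q s' where p: "p \<in> prob_simplex" "0 \<le> s"
      "a = (\<Sum>x\<in>UNIV. p $ x * f x, vec_information p + s)"
    and q: "q \<in> prob_simplex" "0 \<le> s'" "b = (\<Sum>x\<in>UNIV. q $ x * f x, vec_information q + s')"
    by blast
  define m where "m = u *\<^sub>R p + v *\<^sub>R q"
  define z where "z = u * (vec_information p + s) + v * (vec_information q + s') - vec_information m"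
  have "m \<in> prob_simplex"
    unfolding m_def using convexD[OF convex_prob_simplex p(1) q(1) uv] .
  moreover have "0 \<le> u * s + v * s'"
    using uv p(2) q(2) by simp
  then have "0 \<le> z"
    using vec_information_convex[OF p(1) q(1) uv] unfolding z_def m_def
    by (simp add: distrib_left)
  moreover have "u *\<^sub>R a + v *\<^sub>R b = (\<Sum>x\<in>UNIV. m $ x * f x, vec_information m + z)"
    by (simp add: p(3) q(3) m_def z_def sum.distrib sum_distrib_left algebra_simps)
  ultimately show "u *\<^sub>R a + v *\<^sub>R b
      \<in> {(\<Sum>x\<in>UNIV. p $ x * f x, vec_information p + s) | p s. p \<in> prob_simplex \<and> 0 \<le> s}"
    by blast
qed

text \<open>Interpolation between \<open>\<pi>\<close>, which has mean \<open>0\<close>, and the point mass at \<open>y\<close>.\<close>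
lemma exists_measure_with_mean:
  fixes f :: "'e \<Rightarrow> real"
  assumes mean: "measure_pmf.expectation \<pi> f = 0" and "0 \<le> u" "u \<le> f y"
  obtains \<beta> where "measure_pmf.expectation \<beta> f = u"
proof (cases "u = 0")
  case True
  then show ?thesis using that mean by blast
next
  case False
  define \<theta> where "\<theta> = u / f y"
  have \<theta>: "0 \<le> \<theta>" "\<theta> \<le> 1" "\<theta> * f y = u"
    using assms(2,3) False by (auto simp: \<theta>_def)
  have \<pi>f: "(\<Sum>x\<in>UNIV. pmf \<pi> x * f x) = 0"
    using mean by (simp add: expectation_pmf_finite)
  obtain \<beta> where \<beta>: "pmf \<beta> = (\<lambda>x. (if x = y then \<theta> else 0) + (1 - \<theta>) * pmf \<pi> x)"
  proof (rule pmf_of_weights)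
    show "(\<Sum>x\<in>UNIV. (if x = y then \<theta> else 0) + (1 - \<theta>) * pmf \<pi> x) = 1"
      by (simp add: sum.distrib sum_distrib_left[symmetric] sum_pmf_eq_1)
  qed (use \<theta> in auto)
  have "measure_pmf.expectation \<beta> f
      = (\<Sum>x\<in>UNIV. (if x = y then \<theta> * f x else 0) + (1 - \<theta>) * (pmf \<pi> x * f x))"
    unfolding expectation_pmf_finite \<beta> by (intro sum.cong refl) (simp add: algebra_simps)
  also have "\<dots> = \<theta> * f y + (1 - \<theta>) * (\<Sum>x\<in>UNIV. pmf \<pi> x * f x)"
    by (simp add: sum.distrib sum_distrib_left)
  finally show ?thesis
    using that \<theta>(3) \<pi>f by simp
qed

text \<open>A line through \<open>(u, a - \<epsilon>)\<close> separating it from the region above the information function has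
  slope \<open>r\<close>. It is not vertical, because some measure has mean exactly \<open>u\<close>. It is nonnegative when
  \<open>a > \<epsilon>\<close>, because the line then passes above \<open>0\<close> at \<open>u \<ge> 0\<close> but below \<open>I(\<pi>|\<pi>) = 0\<close> at the mean
  \<open>0\<close> of \<open>\<pi>\<close>; when \<open>a \<le> \<epsilon>\<close> the horizontal line will do.\<close>
lemma exists_tangent_slope:
  assumes mean: "measure_pmf.expectation \<pi> f = 0"
    and "0 \<le> u"
    and attained: "measure_pmf.expectation \<beta>\<^sub>0 f = u"
    and lower: "\<And>\<beta>. measure_pmf.expectation \<beta> f = u \<Longrightarrow> a \<le> DV_information Q \<pi> \<beta>"
    and "0 < \<epsilon>"
  obtains r where "0 \<le> r"
    "\<And>\<beta>. r * measure_pmf.expectation \<beta> f - DV_information Q \<pi> \<beta> \<le> r * u - (a - \<epsilon>)"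
proof (cases "a \<le> \<epsilon>")
  case True
  show ?thesis
  proof (rule that)
    show "0 * measure_pmf.expectation \<beta> f - DV_information Q \<pi> \<beta> \<le> 0 * u - (a - \<epsilon>)" for \<beta>
      using DV_information_nonneg[of \<beta>] True by simp
  qed simp
next
  case False
  let ?C = "{(\<Sum>x\<in>UNIV. p $ x * f x, vec_information p + s) | p s. p \<in> prob_simplex \<and> 0 \<le> s}"
  have C: "(measure_pmf.expectation \<beta> f, DV_information Q \<pi> \<beta>) \<in> ?C" for \<beta>
    using prob_simplex_iff
    by (intro CollectI exI[of _ "\<chi> x. pmf \<beta> x"] exI[of _ 0])
      (auto simp: expectation_pmf_finite vec_information_def DV_information_eq)
  have "(u, a - \<epsilon>) \<notin> ?C"
  proof
    assume "(u, a - \<epsilon>) \<in> ?C"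
    then obtain \<beta> s where "0 \<le> s" "u = measure_pmf.expectation \<beta> f"
        "a - \<epsilon> = DV_information Q \<pi> \<beta> + s"
      by (auto simp: prob_simplex_iff expectation_pmf_finite vec_information_def DV_information_eq)
    then show False
      using lower[of \<beta>] \<open>0 < \<epsilon>\<close> by simp
  qed
  then have "\<exists>w b. inner w (u, a - \<epsilon>) < b \<and> (\<forall>z\<in>?C. b < inner w z)"
    by (rule separating_hyperplane_closed_point[OF convex_information_epigraph closed_information_epigraph])
  then obtain w b where wb: "inner w (u, a - \<epsilon>) < b" "\<forall>z\<in>?C. b < inner w z"
    by (elim exE conjE)
  define k l where "k = fst w" and "l = snd w"
  have sep: "k * u + l * (a - \<epsilon>)
      < k * measure_pmf.expectation \<beta> f + l * DV_information Q \<pi> \<beta>" for \<beta>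
    using wb(1) wb(2)[rule_format, OF C[of \<beta>]]
    by (simp add: inner_prod_def k_def l_def)
  have "0 < l"
  proof -
    have *: "0 < l * (DV_information Q \<pi> \<beta>\<^sub>0 - a + \<epsilon>)"
      using sep[of \<beta>\<^sub>0] by (simp add: attained algebra_simps)
    have "0 < DV_information Q \<pi> \<beta>\<^sub>0 - a + \<epsilon>"
      using lower[OF attained] \<open>0 < \<epsilon>\<close> by simp
    with * show ?thesis by (simp add: zero_less_mult_iff)
  qed
  define r where "r = - k / l"
  have key: "r * measure_pmf.expectation \<beta> f - DV_information Q \<pi> \<beta> < r * u - (a - \<epsilon>)" for \<beta>
  proof -
    have "k = - (r * l)"
      using \<open>0 < l\<close> by (simp add: r_def)
    then have "0 < l * (r * u - (a - \<epsilon>) - (r * measure_pmf.expectation \<beta> f - DV_information Q \<pi> \<beta>))"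
      using sep[of \<beta>] by (simp add: algebra_simps)
    then show ?thesis
      using \<open>0 < l\<close> by (simp add: zero_less_mult_iff)
  qed
  have "0 < r * u"
    using key[of \<pi>] False by (simp add: mean DV_information_stationary)
  then have "0 \<le> r"
    using \<open>0 \<le> u\<close> by (simp add: zero_less_mult_iff)
  then show ?thesis
    using key by (intro that[of r]) (auto intro: less_imp_le)
qed

end

section \<open>Growth of the tilted semigroup\<close>

text \<open>One step of length \<open>h\<close> in the splitting approximation of the semigroup generated by
  \<open>L + r f\<close>.\<close>
definition tilted_step ::
    "real ^ 'e ^ 'e \<Rightarrow> ('e::finite \<Rightarrow> real) \<Rightarrow> real \<Rightarrow> real \<Rightarrow> ('e \<Rightarrow> real) \<Rightarrow> 'e \<Rightarrow> real" where
  "tilted_step Q f r h g =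
     kernel_op (\<lambda>x y. matrix_exp (h *\<^sub>R Q) $ x $ y) (\<lambda>y. exp (h * (r * f y)) * g y)"

context stationary_generator
begin

text \<open>The squared norm of the step is a quadratic form in \<open>g\<close> whose matrix \<open>G h\<close> is differentiable at
  \<open>h = 0\<close>. There \<open>G 0\<close> is the squared norm of \<open>g\<close> and the derivative \<open>D\<close> is twice the form of
  \<open>L + r f\<close>, so that \<open>1 + 2 h c\<close> bounds the first-order growth. The remainder is \<open>o(h)\<close> uniformly in \<open>g\<close>
  because only finitely many matrix entries occur.\<close>
lemma tilted_step_norm_growth:
  assumes form_le: "\<And>g. r * inner_L2 \<pi> (\<lambda>x. f x * g x) g - energy g \<le> c * inner_L2 \<pi> g g"
    and "0 < \<epsilon>"
  shows "\<forall>\<^sub>F h in at_right 0. \<forall>g. inner_L2 \<pi> (tilted_step Q f r h g) (tilted_step Q f r h g)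
    \<le> exp (2 * h * (c + \<epsilon>)) * inner_L2 \<pi> g g"
proof -
  define m where "m h x y = matrix_exp (h *\<^sub>R Q) $ x $ y * exp (h * (r * f y))" for h x y
  define b where "b x y = Q $ x $ y + (if x = y then r * f y else 0)" for x y
  define G where "G h x y = (\<Sum>z\<in>UNIV. pmf \<pi> z * (m h z x * m h z y))" for h x y
  define D where "D x y = pmf \<pi> x * b x y + pmf \<pi> y * b y x" for x y
  have m0: "m 0 x y = (if x = y then 1 else 0)" for x y
    using matrix_exp_entry_sums[where A = Q and x = x and y = y and t = 0, THEN sums_unique]
    unfolding powser_zero by (simp add: m_def mat_def)
  have m_deriv: "((\<lambda>h. m h x y) has_real_derivative b x y) (at 0)" for x y
  proof -
    have "((\<lambda>h. exp (h * (r * f y))) has_real_derivative r * f y) (at 0)"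
      by (auto intro!: derivative_eq_intros)
    then have "((\<lambda>h. m h x y) has_real_derivative
        (Q $ x $ y * exp (0 * (r * f y)) + r * f y * matrix_exp (0 *\<^sub>R Q) $ x $ y)) (at 0)"
      unfolding m_def by (intro DERIV_mult matrix_exp_entry_derivative_0)
    moreover have "matrix_exp (0 *\<^sub>R Q) $ x $ y = (if x = y then 1 else 0)"
      using m0[of x y] by (simp add: m_def)
    ultimately show ?thesis by (simp add: b_def mult_ac cong: if_cong split: if_splits)
  qed
  have G0: "G 0 x y = (if x = y then pmf \<pi> x else 0)" for x y
  proof -
    have "G 0 x y = (\<Sum>z\<in>UNIV. if z = x then (if x = y then pmf \<pi> x else 0) else 0)"
      unfolding G_def by (intro sum.cong refl) (simp add: m0)
    then show ?thesis by simp
  qed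
  have G_deriv: "((\<lambda>h. G h x y) has_real_derivative D x y) (at 0)" for x y
  proof -
    have "((\<lambda>h. G h x y) has_real_derivative
        (\<Sum>z\<in>UNIV. pmf \<pi> z * (b z x * m 0 z y + b z y * m 0 z x))) (at 0)"
      unfolding G_def by (intro DERIV_sum DERIV_cmult DERIV_mult m_deriv)
    moreover have "(\<Sum>z\<in>UNIV. pmf \<pi> z * (b z x * m 0 z y + b z y * m 0 z x))
        = (\<Sum>z\<in>UNIV. (if z = y then pmf \<pi> z * b z x else 0) + (if z = x then pmf \<pi> z * b z y else 0))"
      by (intro sum.cong refl) (simp add: m0 distrib_left)
    moreover have "\<dots> = D x y"
      by (simp add: D_def sum.distrib)
    ultimately show ?thesis by simp
  qed
  \<comment> \<open>\<open>\<kappa>\<close> compares the squared \<open>l\<^sup>1\<close> norm with the weighted \<open>L\<^sup>2\<close> norm, and \<open>\<delta>\<close> is the error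
    per matrix entry that adds up to \<open>2 h \<epsilon>\<close>.\<close>
  define \<kappa> where "\<kappa> = (\<Sum>x\<in>UNIV. 1 / pmf \<pi> x)"
  have "0 < \<kappa>"
    unfolding \<kappa>_def by (rule sum_pos) (auto simp: weight_pos)
  define \<delta> where "\<delta> = 2 * \<epsilon> / \<kappa>"
  have "0 < \<delta>" using \<open>0 < \<epsilon>\<close> \<open>0 < \<kappa>\<close> by (simp add: \<delta>_def)
  have "\<forall>\<^sub>F h in at_right 0. \<bar>G h x y - G 0 x y - h * D x y\<bar> \<le> h * \<delta>" for x y
  proof -
    have "((\<lambda>h. (G h x y - G 0 x y) / h) \<longlongrightarrow> D x y) (at 0)"
      using G_deriv[of x y] by (simp add: has_field_derivative_iff)
    then have "((\<lambda>h. (G h x y - G 0 x y) / h) \<longlongrightarrow> D x y) (at_right 0)"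
      by (rule tendsto_mono[OF at_le, rotated]) simp
    then have "\<forall>\<^sub>F h in at_right 0. dist ((G h x y - G 0 x y) / h) (D x y) < \<delta>"
      using \<open>0 < \<delta>\<close> by (rule tendstoD)
    moreover have "\<forall>\<^sub>F h in at_right (0 :: real). 0 < h"
      by (simp add: eventually_at_right_less)
    ultimately show ?thesis
    proof eventually_elim
      case (elim h)
      have "\<bar>G h x y - G 0 x y - h * D x y\<bar> = h * \<bar>(G h x y - G 0 x y) / h - D x y\<bar>"
      proof -
        have "G h x y - G 0 x y - h * D x y = h * ((G h x y - G 0 x y) / h - D x y)"
          using elim(2) by (simp add: field_simps)
        then show ?thesis using elim(2) by (simp only: abs_mult abs_of_pos)
      qed
      also have "\<dots> \<le> h * \<delta>"
        using elim by (intro mult_left_mono) (auto simp: dist_real_def)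
      finally show ?case .
    qed
  qed
  then have "\<forall>\<^sub>F h in at_right 0. \<forall>x y. \<bar>G h x y - G 0 x y - h * D x y\<bar> \<le> h * \<delta>"
    by (intro eventually_all_finite)
  moreover have "\<forall>\<^sub>F h in at_right (0 :: real). 0 < h"
    by (simp add: eventually_at_right_less)
  ultimately show ?thesis
  proof eventually_elim
    case (elim h)
    show ?case
    proof
      fix g
      define T where "T = tilted_step Q f r h g"
      define N where "N = inner_L2 \<pi> g g"
      have T: "T z = (\<Sum>x\<in>UNIV. m h z x * g x)" for z
        by (simp add: T_def tilted_step_def kernel_op_def m_def mult_ac)
      have "inner_L2 \<pi> T T = (\<Sum>z\<in>UNIV. \<Sum>x\<in>UNIV. \<Sum>y\<in>UNIV. pmf \<pi> z * (m h z x * m h z y) * (g x * g y))"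
        unfolding inner_L2_def T sum_product sum_distrib_left sum_distrib_right
        by (intro sum.cong refl) (simp add: mult_ac)
      also have "\<dots> = (\<Sum>x\<in>UNIV. \<Sum>y\<in>UNIV. G h x y * (g x * g y))"
        unfolding G_def sum_distrib_right
        by (subst sum.swap) (intro sum.cong refl sum.swap)
      also have "\<dots> \<le> (\<Sum>x\<in>UNIV. \<Sum>y\<in>UNIV.
          G 0 x y * (g x * g y) + h * (D x y * (g x * g y)) + h * \<delta> * (\<bar>g x\<bar> * \<bar>g y\<bar>))"
      proof (intro sum_mono)
        fix x y
        have "(G h x y - G 0 x y - h * D x y) * (g x * g y) \<le> h * \<delta> * (\<bar>g x\<bar> * \<bar>g y\<bar>)"
        proof (rule order_trans[OF abs_ge_self])
          show "\<bar>(G h x y - G 0 x y - h * D x y) * (g x * g y)\<bar> \<le> h * \<delta> * (\<bar>g x\<bar> * \<bar>g y\<bar>)"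
            unfolding abs_mult[of _ "g x * g y"] abs_mult[of "g x"] using elim(1) by (intro mult_right_mono) auto
        qed
        then show "G h x y * (g x * g y)
            \<le> G 0 x y * (g x * g y) + h * (D x y * (g x * g y)) + h * \<delta> * (\<bar>g x\<bar> * \<bar>g y\<bar>)"
          by (simp add: algebra_simps)
      qed
      also have "\<dots> = (\<Sum>x\<in>UNIV. \<Sum>y\<in>UNIV. G 0 x y * (g x * g y))
          + h * (\<Sum>x\<in>UNIV. \<Sum>y\<in>UNIV. D x y * (g x * g y))
          + h * \<delta> * (\<Sum>x\<in>UNIV. \<Sum>y\<in>UNIV. \<bar>g x\<bar> * \<bar>g y\<bar>)"
        by (simp only: sum.distrib sum_distrib_left)
      also have "(\<Sum>x\<in>UNIV. \<Sum>y\<in>UNIV. G 0 x y * (g x * g y)) = N"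
      proof -
        have "(\<Sum>x\<in>UNIV. \<Sum>y\<in>UNIV. G 0 x y * (g x * g y))
            = (\<Sum>x\<in>UNIV. \<Sum>y\<in>UNIV. if x = y then pmf \<pi> x * (g x * g y) else 0)"
          by (intro sum.cong refl) (simp add: G0)
        then show ?thesis by (simp add: N_def inner_L2_def mult_ac)
      qed
      also have "(\<Sum>x\<in>UNIV. \<Sum>y\<in>UNIV. D x y * (g x * g y))
          = 2 * (r * inner_L2 \<pi> (\<lambda>x. f x * g x) g - energy g)"
      proof -
        have "(\<Sum>x\<in>UNIV. \<Sum>y\<in>UNIV. D x y * (g x * g y))
            = (\<Sum>x\<in>UNIV. \<Sum>y\<in>UNIV. pmf \<pi> x * b x y * (g x * g y))
            + (\<Sum>x\<in>UNIV. \<Sum>y\<in>UNIV. pmf \<pi> y * b y x * (g y * g x))"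
          unfolding sum.distrib[symmetric]
          by (intro sum.cong refl) (simp add: D_def algebra_simps)
        also have "(\<Sum>x\<in>UNIV. \<Sum>y\<in>UNIV. pmf \<pi> y * b y x * (g y * g x))
            = (\<Sum>x\<in>UNIV. \<Sum>y\<in>UNIV. pmf \<pi> x * b x y * (g x * g y))"
          by (rule sum.swap)
        also have "(\<Sum>x\<in>UNIV. \<Sum>y\<in>UNIV. pmf \<pi> x * b x y * (g x * g y))
            = (\<Sum>x\<in>UNIV. \<Sum>y\<in>UNIV. pmf \<pi> x * Q $ x $ y * (g x * g y))
            + (\<Sum>x\<in>UNIV. \<Sum>y\<in>UNIV. if x = y then r * (f x * g x * g x * pmf \<pi> x) else 0)"
          unfolding sum.distrib[symmetric]
          by (intro sum.cong refl) (simp add: b_def algebra_simps)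
        also have "\<dots> = r * inner_L2 \<pi> (\<lambda>x. f x * g x) g - energy g"
          by (simp add: energy_eq_sum inner_L2_def sum_distrib_left)
        finally show ?thesis by simp
      qed
      also have "(\<Sum>x\<in>UNIV. \<Sum>y\<in>UNIV. \<bar>g x\<bar> * \<bar>g y\<bar>) = (\<Sum>x\<in>UNIV. \<bar>g x\<bar>)\<^sup>2"
        by (simp add: power2_eq_square sum_product)
      finally have "inner_L2 \<pi> T T
          \<le> N + h * (2 * (r * inner_L2 \<pi> (\<lambda>x. f x * g x) g - energy g)) + h * \<delta> * (\<Sum>x\<in>UNIV. \<bar>g x\<bar>)\<^sup>2" .
      also have "\<dots> \<le> N + h * (2 * (c * N)) + h * \<delta> * (\<kappa> * N)"
      proof (intro add_mono mult_left_mono form_le[of g, folded N_def])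
        have "(\<Sum>x\<in>UNIV. \<bar>g x\<bar>)\<^sup>2 = (\<Sum>x\<in>UNIV. (1 / sqrt (pmf \<pi> x)) * (sqrt (pmf \<pi> x) * \<bar>g x\<bar>))\<^sup>2"
          by (simp add: weight_neq_0)
        also have "\<dots> \<le> (\<Sum>x\<in>UNIV. (1 / sqrt (pmf \<pi> x))\<^sup>2) * (\<Sum>x\<in>UNIV. (sqrt (pmf \<pi> x) * \<bar>g x\<bar>)\<^sup>2)"
          by (rule Cauchy_Schwarz_ineq_sum)
        also have "\<dots> = \<kappa> * N"
          by (simp add: \<kappa>_def N_def inner_L2_def power_divide power_mult_distrib power2_eq_square[of "g _"] mult_ac)
        finally show "(\<Sum>x\<in>UNIV. \<bar>g x\<bar>)\<^sup>2 \<le> \<kappa> * N" .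
      qed (use elim(2) \<open>0 < \<delta>\<close> in auto)
      also have "\<dots> = (1 + 2 * h * (c + \<epsilon>)) * N"
        using \<open>0 < \<kappa>\<close> by (simp add: \<delta>_def algebra_simps)
      also have "\<dots> \<le> exp (2 * h * (c + \<epsilon>)) * N"
        unfolding N_def by (intro mult_right_mono exp_ge_add_one_self inner_L2_nonneg)
      finally show "inner_L2 \<pi> (tilted_step Q f r h g) (tilted_step Q f r h g)
          \<le> exp (2 * h * (c + \<epsilon>)) * inner_L2 \<pi> g g"
        unfolding T_def N_def .
    qed
  qed
qed

end

section \<open>Exponential moments and the tail bound\<close>

context markov_jump_process
begin

text \<open>A right-continuous path in a discrete space is constant immediately to the right of each time,
  so that \<open>f (X s)\<close> has the right limits needed for the Riemann sums.\<close>
lemma grid_sum_tendsto_additive_functional: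
  assumes "0 < t" "\<omega> \<in> space M"
  shows "(\<lambda>n. (\<Sum>k<Suc n. f (X (real (Suc k) * (t / Suc n)) \<omega>)) * (t / Suc n))
    \<longlonglongrightarrow> additive_functional X f t \<omega>"
  unfolding additive_functional_def
proof (rule right_riemann_sums_tendsto[OF \<open>0 < t\<close>])
  show "\<bar>f (X s \<omega>)\<bar> \<le> Max (range (\<lambda>x. \<bar>f x\<bar>))" for s
    by (rule Max_ge) auto
  show "((\<lambda>s. f (X s \<omega>)) \<longlongrightarrow> f (X s \<omega>)) (at_right s)" if "0 \<le> s" for s
    using right_continuous[OF assms(2) that]
    by (intro tendsto_eventually) (auto elim: eventually_mono)
qed

lemma measurable_additive_functional:
  assumes "0 < t"
  shows "additive_functional X f t \<in> borel_measurable (P x)"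
proof (rule borel_measurable_LIMSEQ_real[where
      u = "\<lambda>n \<omega>. (\<Sum>k<Suc n. f (X (real (Suc k) * (t / Suc n)) \<omega>)) * (t / Suc n)"])
  show "(\<lambda>\<omega>. (\<Sum>k<Suc n. f (X (real (Suc k) * (t / Suc n)) \<omega>)) * (t / Suc n)) \<in> borel_measurable (P x)" for n
    using assms
    by (intro borel_measurable_times borel_measurable_sum measurable_compose[OF measurable_X_P]) auto
qed (unfold space_P, rule grid_sum_tendsto_additive_functional[OF assms])

text \<open>The exponential of the grid sum is a product over the grid, so its expectation is the iterated
  step applied to \<open>1\<close>, and averaging over \<open>\<nu>\<close> is pairing with \<open>d\<nu>/d\<pi>\<close> in \<open>L\<^sup>2(\<pi>)\<close>.\<close>
lemma grid_exponential_moment_le: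
  assumes "stationary_generator Q \<pi>" and rate: "rate_matrix M X P Q" and "0 \<le> h"
    and growth: "\<And>g. inner_L2 \<pi> (tilted_step Q f r h g) (tilted_step Q f r h g)
        \<le> exp (2 * h * c) * inner_L2 \<pi> g g"
  shows "(\<Sum>x\<in>UNIV. pmf \<nu> x * (\<integral>\<omega>. exp (r * ((\<Sum>k<n. f (X (real (Suc k) * h) \<omega>)) * h)) \<partial>P x))
    \<le> norm_L2 \<pi> (pmf_density \<nu> \<pi>) * exp (real n * h * c)"
proof -
  interpret stationary_generator Q \<pi> by fact
  define T where "T = tilted_step Q f r h"
  have "transition_prob M X P h = (\<lambda>x y. matrix_exp (h *\<^sub>R Q) $ x $ y)"
    using rate \<open>0 \<le> h\<close> by (simp add: rate_matrix_def fun_eq_iff)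
  then have T_eq: "T = (\<lambda>g. kernel_op (transition_prob M X P h) (\<lambda>y. exp (h * (r * f y)) * g y))"
    by (simp only: T_def tilted_step_def[abs_def])
  have iterate: "inner_L2 \<pi> ((T ^^ k) (\<lambda>_. 1)) ((T ^^ k) (\<lambda>_. 1)) \<le> exp (2 * h * c) ^ k" for k
  proof (induction k)
    case 0
    then show ?case by (simp add: inner_L2_def sum_pmf_eq_1)
  next
    case (Suc k)
    have "inner_L2 \<pi> ((T ^^ Suc k) (\<lambda>_. 1)) ((T ^^ Suc k) (\<lambda>_. 1))
        \<le> exp (2 * h * c) * inner_L2 \<pi> ((T ^^ k) (\<lambda>_. 1)) ((T ^^ k) (\<lambda>_. 1))"
      using growth[of "(T ^^ k) (\<lambda>_. 1)"] by (simp add: T_def)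
    also have "\<dots> \<le> exp (2 * h * c) * exp (2 * h * c) ^ k"
      by (intro mult_left_mono Suc) auto
    finally show ?case by simp
  qed
  have "(\<integral>\<omega>. exp (r * ((\<Sum>k<n. f (X (real (Suc k) * h) \<omega>)) * h)) \<partial>P x) = (T ^^ n) (\<lambda>_. 1) x" for x
  proof -
    have "exp (r * ((\<Sum>k<n. f (X (real (Suc k) * h) \<omega>)) * h))
        = (\<Prod>k<n. exp (h * (r * f (X (real (Suc k) * h) \<omega>))))" for \<omega>
      by (simp add: exp_sum[symmetric] sum_distrib_left sum_distrib_right mult_ac)
    then show ?thesis
      using expectation_product_along_grid[OF \<open>0 \<le> h\<close>, where \<phi> = "\<lambda>y. exp (h * (r * f y))"
          and n = n and g = "\<lambda>_. 1" and x = x]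
      by (simp add: T_eq)
  qed
  then have "(\<Sum>x\<in>UNIV. pmf \<nu> x * (\<integral>\<omega>. exp (r * ((\<Sum>k<n. f (X (real (Suc k) * h) \<omega>)) * h)) \<partial>P x))
      = inner_L2 \<pi> (pmf_density \<nu> \<pi>) ((T ^^ n) (\<lambda>_. 1))"
    by (simp add: inner_L2_def pmf_density_def weight_neq_0)
  also have "\<dots> \<le> norm_L2 \<pi> (pmf_density \<nu> \<pi>) * norm_L2 \<pi> ((T ^^ n) (\<lambda>_. 1))"
    by (rule inner_L2_Cauchy_Schwarz)
  also have "\<dots> \<le> norm_L2 \<pi> (pmf_density \<nu> \<pi>) * exp (real n * h * c)"
  proof (rule mult_left_mono)
    have "exp (2 * h * c) ^ n = (exp (real n * h * c))\<^sup>2"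
      by (simp add: exp_of_nat_mult[symmetric] exp_double[symmetric] mult_ac)
    then show "norm_L2 \<pi> ((T ^^ n) (\<lambda>_. 1)) \<le> exp (real n * h * c)"
      using iterate[of n] unfolding norm_L2_def by (intro real_le_lsqrt) auto
  qed (simp add: norm_L2_def inner_L2_nonneg)
  finally show ?thesis .
qed

lemma abs_grid_sum_le:
  assumes "0 < t"
  shows "\<bar>(\<Sum>k<Suc n. f (X (real (Suc k) * (t / Suc n)) \<omega>)) * (t / Suc n)\<bar>
    \<le> Max (range (\<lambda>x. \<bar>f x\<bar>)) * t"
proof -
  have "\<bar>\<Sum>k<Suc n. f (X (real (Suc k) * (t / Suc n)) \<omega>)\<bar> \<le> (\<Sum>k<Suc n. Max (range (\<lambda>x. \<bar>f x\<bar>)))"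
    by (rule order_trans[OF sum_abs]) (intro sum_mono Max_ge, auto)
  then have "\<bar>\<Sum>k<Suc n. f (X (real (Suc k) * (t / Suc n)) \<omega>)\<bar> * (t / Suc n)
      \<le> (real (Suc n) * Max (range (\<lambda>x. \<bar>f x\<bar>))) * (t / Suc n)"
    using assms by (intro mult_right_mono) auto
  also have "\<dots> = Max (range (\<lambda>x. \<bar>f x\<bar>)) * t"
    by simp
  finally show ?thesis
    using assms by (simp add: abs_mult)
qed

lemma exponential_moment_limit:
  assumes "0 < t"
  shows "integrable (P x) (\<lambda>\<omega>. exp (r * additive_functional X f t \<omega>))"
    and "(\<lambda>n. \<integral>\<omega>. exp (r * ((\<Sum>k<Suc n. f (X (real (Suc k) * (t / Suc n)) \<omega>)) * (t / Suc n))) \<partial>P x)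
      \<longlonglongrightarrow> (\<integral>\<omega>. exp (r * additive_functional X f t \<omega>) \<partial>P x)"
proof -
  interpret prob_space "P x" by (rule prob_space_P)
  define S where "S n \<omega> = (\<Sum>k<Suc n. f (X (real (Suc k) * (t / Suc n)) \<omega>)) * (t / Suc n)" for n \<omega>
  define B where "B = Max (range (\<lambda>x. \<bar>f x\<bar>)) * t"
  have [measurable]: "S n \<in> borel_measurable (P x)" for n
    unfolding S_def using assms
    by (intro borel_measurable_times borel_measurable_sum measurable_compose[OF measurable_X_P]) auto
  have [measurable]: "additive_functional X f t \<in> borel_measurable (P x)"
    by (rule measurable_additive_functional[OF assms])
  have lim: "AE \<omega> in P x. (\<lambda>n. exp (r * S n \<omega>)) \<longlonglongrightarrow> exp (r * additive_functional X f t \<omega>)"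
    unfolding S_def
    by (intro AE_I2 tendsto_intros grid_sum_tendsto_additive_functional[OF assms])
      (simp add: space_P)
  have bound: "AE \<omega> in P x. norm (exp (r * S n \<omega>)) \<le> exp (\<bar>r\<bar> * B)" for n
  proof (rule AE_I2)
    fix \<omega>
    have "r * S n \<omega> \<le> \<bar>r\<bar> * \<bar>S n \<omega>\<bar>"
      using abs_ge_self[of "r * S n \<omega>"] by (simp add: abs_mult)
    also have "\<dots> \<le> \<bar>r\<bar> * B"
      unfolding S_def B_def by (intro mult_left_mono abs_grid_sum_le[OF assms]) auto
    finally show "norm (exp (r * S n \<omega>)) \<le> exp (\<bar>r\<bar> * B)" by simp
  qed
  show "integrable (P x) (\<lambda>\<omega>. exp (r * additive_functional X f t \<omega>))"
    by (rule integrable_dominated_convergence[OF _ _ _ lim bound]) auto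
  show "(\<lambda>n. \<integral>\<omega>. exp (r * ((\<Sum>k<Suc n. f (X (real (Suc k) * (t / Suc n)) \<omega>)) * (t / Suc n))) \<partial>P x)
      \<longlonglongrightarrow> (\<integral>\<omega>. exp (r * additive_functional X f t \<omega>) \<partial>P x)"
    unfolding S_def[symmetric]
    by (rule integral_dominated_convergence[OF _ _ _ lim bound]) auto
qed

text \<open>Cutting \<open>[0, t]\<close> into \<open>n\<close> steps gives the growth factor \<open>exp (2 (t / n) (c + \<epsilon>))\<close> to the power
  \<open>n\<close> for the squared norm, which does not depend on \<open>n\<close>. Hence the bound survives first \<open>n \<rightarrow> \<infinity>\<close> and
  then \<open>\<epsilon> \<rightarrow> 0\<close>.\<close>
lemma exponential_moment_le:
  assumes "stationary_generator Q \<pi>" and rate: "rate_matrix M X P Q" and "0 < t"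
    and form_le: "\<And>\<beta>. r * measure_pmf.expectation \<beta> f - DV_information Q \<pi> \<beta> \<le> c"
  shows "(\<Sum>x\<in>UNIV. pmf \<nu> x * (\<integral>\<omega>. exp (r * additive_functional X f t \<omega>) \<partial>P x))
    \<le> norm_L2 \<pi> (pmf_density \<nu> \<pi>) * exp (t * c)"
proof -
  interpret stationary_generator Q \<pi> by fact
  let ?m = "\<Sum>x\<in>UNIV. pmf \<nu> x * (\<integral>\<omega>. exp (r * additive_functional X f t \<omega>) \<partial>P x)"
  have le: "?m \<le> norm_L2 \<pi> (pmf_density \<nu> \<pi>) * exp (t * (c + \<epsilon>))" if "0 < \<epsilon>" for \<epsilon>
  proof (rule tendsto_upperbound)
    show "(\<lambda>n. \<Sum>x\<in>UNIV. pmf \<nu> x *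
        (\<integral>\<omega>. exp (r * ((\<Sum>k<Suc n. f (X (real (Suc k) * (t / Suc n)) \<omega>)) * (t / Suc n))) \<partial>P x)) \<longlonglongrightarrow> ?m"
      by (intro tendsto_sum tendsto_mult tendsto_const exponential_moment_limit(2)[OF \<open>0 < t\<close>])
    have mesh: "filterlim (\<lambda>n. t / Suc n) (at_right 0) sequentially"
      using \<open>0 < t\<close> by real_asymp
    have "\<forall>\<^sub>F n in sequentially. \<forall>g.
        inner_L2 \<pi> (tilted_step Q f r (t / Suc n) g) (tilted_step Q f r (t / Suc n) g)
        \<le> exp (2 * (t / Suc n) * (c + \<epsilon>)) * inner_L2 \<pi> g g"
      by (rule filterlim_iff[THEN iffD1, OF mesh, rule_format,
          OF tilted_step_norm_growth[OF form_le_if_variational_le[OF form_le] \<open>0 < \<epsilon>\<close>]])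
    then show "\<forall>\<^sub>F n in sequentially. (\<Sum>x\<in>UNIV. pmf \<nu> x *
        (\<integral>\<omega>. exp (r * ((\<Sum>k<Suc n. f (X (real (Suc k) * (t / Suc n)) \<omega>)) * (t / Suc n))) \<partial>P x))
        \<le> norm_L2 \<pi> (pmf_density \<nu> \<pi>) * exp (t * (c + \<epsilon>))"
    proof eventually_elim
      case (elim n)
      then show ?case
        using grid_exponential_moment_le[OF assms(1) rate, where h = "t / Suc n" and n = "Suc n"
            and r = r and f = f and c = "c + \<epsilon>" and \<nu> = \<nu>] \<open>0 < t\<close>
        by simp
    qed
  qed simp
  have "((\<lambda>\<epsilon>. norm_L2 \<pi> (pmf_density \<nu> \<pi>) * exp (t * (c + \<epsilon>)))
      \<longlongrightarrow> norm_L2 \<pi> (pmf_density \<nu> \<pi>) * exp (t * (c + 0))) (at_right 0)"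
    by (intro tendsto_intros)
  moreover have "\<forall>\<^sub>F \<epsilon> in at_right 0. ?m \<le> norm_L2 \<pi> (pmf_density \<nu> \<pi>) * exp (t * (c + \<epsilon>))"
    using eventually_at_right_less[of "0 :: real"] by eventually_elim (rule le)
  ultimately show ?thesis
    using tendsto_lowerbound[of _ _ "at_right (0 :: real)" ?m] by simp
qed

text \<open>On the event, \<open>exp (r (A\<^sub>t - t u)) \<ge> 1\<close>, because \<open>r \<ge> 0\<close>; hence the exponential moment controls its
  probability.\<close>
lemma additive_functional_tail_le:
  assumes "stationary_generator Q \<pi>" and rate: "rate_matrix M X P Q" and "0 < t" "0 \<le> r"
    and form_le: "\<And>\<beta>. r * measure_pmf.expectation \<beta> f - DV_information Q \<pi> \<beta> \<le> c"
  shows "prob_initial P \<nu> {\<omega> \<in> space M. additive_functional X f t \<omega> / t \<ge> u}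
    \<le> norm_L2 \<pi> (pmf_density \<nu> \<pi>) * exp (- (t * (r * u - c)))"
proof -
  let ?A = "{\<omega> \<in> space M. additive_functional X f t \<omega> / t \<ge> u}"
  have chebyshev: "measure (P x) ?A
      \<le> exp (- (r * (t * u))) * (\<integral>\<omega>. exp (r * additive_functional X f t \<omega>) \<partial>P x)" for x
  proof -
    interpret prob_space "P x" by (rule prob_space_P)
    have [measurable]: "additive_functional X f t \<in> borel_measurable (P x)"
      by (rule measurable_additive_functional[OF \<open>0 < t\<close>])
    have [measurable]: "?A \<in> sets (P x)"
      unfolding space_P[of x, symmetric] by measurable
    have "measure (P x) ?A = (\<integral>\<omega>. indicator ?A \<omega> \<partial>P x)"
      by simp
    also have "\<dots> \<le> (\<integral>\<omega>. exp (- (r * (t * u))) * exp (r * additive_functional X f t \<omega>) \<partial>P x)"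
    proof (rule integral_mono)
      fix \<omega>
      show "indicator ?A \<omega> \<le> exp (- (r * (t * u))) * exp (r * additive_functional X f t \<omega>)"
      proof (cases "\<omega> \<in> ?A")
        case True
        then have "t * u \<le> additive_functional X f t \<omega>"
          using \<open>0 < t\<close> by (simp add: field_simps)
        then have "0 \<le> - (r * (t * u)) + r * additive_functional X f t \<omega>"
          using \<open>0 \<le> r\<close> mult_left_mono by fastforce
        then show ?thesis
          using True by (simp add: exp_add[symmetric])
      qed simp
      show "integrable (P x) (indicat_real ?A)"
        by (intro integrable_real_indicator) (auto simp: less_top[symmetric])
    qed (intro integrable_mult_right exponential_moment_limit(1) \<open>0 < t\<close>)
    finally show ?thesis by simp
  qed
  have "prob_initial P \<nu> ?A \<le> (\<Sum>x\<in>UNIV. pmf \<nu> x *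
      (exp (- (r * (t * u))) * (\<integral>\<omega>. exp (r * additive_functional X f t \<omega>) \<partial>P x)))"
    unfolding prob_initial_def by (intro sum_mono mult_left_mono chebyshev) auto
  also have "\<dots> = exp (- (r * (t * u)))
      * (\<Sum>x\<in>UNIV. pmf \<nu> x * (\<integral>\<omega>. exp (r * additive_functional X f t \<omega>) \<partial>P x))"
    by (simp add: sum_distrib_left mult_ac)
  also have "\<dots> \<le> exp (- (r * (t * u))) * (norm_L2 \<pi> (pmf_density \<nu> \<pi>) * exp (t * c))"
    by (intro mult_left_mono exponential_moment_le[OF assms(1) rate \<open>0 < t\<close>] form_le) simp
  also have "\<dots> = norm_L2 \<pi> (pmf_density \<nu> \<pi>) * exp (- (t * (r * u - c)))"
    by (simp add: algebra_simps exp_add[symmetric] exp_diff exp_minus field_simps)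
  finally show ?thesis .
qed

lemma additive_functional_le:
  assumes "0 < t" "\<omega> \<in> space M" "\<And>x. f x \<le> b"
  shows "additive_functional X f t \<omega> / t \<le> b"
proof -
  have "additive_functional X f t \<omega> \<le> b * t"
  proof (rule LIMSEQ_le_const2[OF grid_sum_tendsto_additive_functional[OF assms(1,2)]])
    have "(\<Sum>k<Suc n. f (X (real (Suc k) * (t / Suc n)) \<omega>)) * (t / Suc n) \<le> b * t" for n
    proof -
      have "(\<Sum>k<Suc n. f (X (real (Suc k) * (t / Suc n)) \<omega>)) \<le> (\<Sum>k<Suc n. b)"
        by (intro sum_mono assms(3))
      then have "(\<Sum>k<Suc n. f (X (real (Suc k) * (t / Suc n)) \<omega>)) * (t / Suc n)
          \<le> (real (Suc n) * b) * (t / Suc n)"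
        using \<open>0 < t\<close> by (intro mult_right_mono) auto
      then show ?thesis by simp
    qed
    then show "\<exists>N. \<forall>n\<ge>N. (\<Sum>k<Suc n. f (X (real (Suc k) * (t / Suc n)) \<omega>)) * (t / Suc n) \<le> b * t"
      by blast
  qed
  then show ?thesis using \<open>0 < t\<close> by (simp add: field_simps)
qed

end

section \<open>The concentration inequality\<close>

theorem theorem3p3p41:
  fixes M :: "'w measure"
    and X :: "real \<Rightarrow> 'w \<Rightarrow> 'e::finite"
    and P :: "'e \<Rightarrow> 'w measure"
    and Q :: "real ^ 'e ^ 'e"
    and \<pi> \<nu> :: "'e pmf"
    and f :: "'e \<Rightarrow> real"
    and \<alpha> :: "real \<Rightarrow> ereal"
  assumes "CARD('e) \<ge> 2"
    and "markov_jump_process M X P"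
    and "irreducible_process M X P"
    and "rate_matrix M X P Q"
    and "invariant_distribution Q \<pi>"
    and "\<exists>x y. f x \<noteq> f y"
    and "measure_pmf.expectation \<pi> f = 0"
    and "\<forall>u\<ge>0. \<alpha> u \<ge> 0"
    and "\<forall>\<beta> :: 'e pmf. measure_pmf.expectation \<beta> f \<ge> 0 \<longrightarrow>
           \<alpha> (measure_pmf.expectation \<beta> f) \<le> ereal (DV_information Q \<pi> \<beta>)"
  shows "(\<forall>t>0. \<forall>u\<ge>0.
            ereal (prob_initial P \<nu> {\<omega> \<in> space M. additive_functional X f t \<omega> / t \<ge> u})
              \<le> ereal (norm_L2 \<pi> (pmf_density \<nu> \<pi>)) * exp_ereal (- (ereal t * \<alpha> u))) \<and>
         (\<forall>r\<ge>0. ereal (lambda0 Q \<pi> f r) \<le> fenchel_conjugate \<alpha> r)"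
proof -
  interpret markov_jump_process M X P by fact
  have gen: "stationary_generator Q \<pi>"
    using assms(4,5) invariant_distribution_pos[OF assms(3-5)]
    by unfold_locales (auto simp: rate_matrix_def invariant_distribution_def)
  interpret stationary_generator Q \<pi> by (rule gen)
  note mean = assms(7)
  have \<alpha>_le: "\<alpha> (measure_pmf.expectation \<beta> f) \<le> ereal (DV_information Q \<pi> \<beta>)"
    if "0 \<le> measure_pmf.expectation \<beta> f" for \<beta>
    using assms(9) that by blast
  let ?p = "\<lambda>t u. prob_initial P \<nu> {\<omega> \<in> space M. additive_functional X f t \<omega> / t \<ge> u}"
  let ?d = "norm_L2 \<pi> (pmf_density \<nu> \<pi>)"
  have d_nonneg: "0 \<le> ?d"
    by (simp add: norm_L2_def inner_L2_nonneg)
  have "ereal (?p t u) \<le> ereal ?d * exp_ereal (- (ereal t * \<alpha> u))" if "0 < t" "0 \<le> u" for t u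
  proof (cases "\<exists>y. u \<le> f y")
    case False
    have "additive_functional X f t \<omega> / t < u" if "\<omega> \<in> space M" for \<omega>
    proof -
      have "additive_functional X f t \<omega> / t \<le> Max (range f)"
        by (rule additive_functional_le[OF \<open>0 < t\<close> that]) simp
      also have "\<dots> < u"
        using False by (subst Max_less_iff) (auto simp: not_le)
      finally show ?thesis .
    qed
    then have empty: "{\<omega> \<in> space M. additive_functional X f t \<omega> / t \<ge> u} = {}"
      by (auto simp: not_le)
    have "?p t u = 0"
      unfolding empty by (simp add: prob_initial_def)
    moreover have "0 \<le> exp_ereal c" for c
      by (cases c) (auto simp: exp_ereal_def)
    ultimately show ?thesis
      using d_nonneg by (simp add: zero_ereal_def[symmetric])
  next
    case True
    then obtain \<beta>\<^sub>0 where \<beta>\<^sub>0: "measure_pmf.expectation \<beta>\<^sub>0 f = u"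
      using exists_measure_with_mean[OF mean \<open>0 \<le> u\<close>] by blast
    have "0 \<le> \<alpha> u" "\<alpha> u \<le> ereal (DV_information Q \<pi> \<beta>\<^sub>0)"
      using assms(8) \<alpha>_le[of \<beta>\<^sub>0] \<beta>\<^sub>0 \<open>0 \<le> u\<close> by auto
    then obtain a where a: "\<alpha> u = ereal a"
      by (cases "\<alpha> u") auto
    have lower: "a \<le> DV_information Q \<pi> \<beta>" if "measure_pmf.expectation \<beta> f = u" for \<beta>
      using \<alpha>_le[of \<beta>] that a \<open>0 \<le> u\<close> by simp
    have "?p t u \<le> ?d * exp (- (t * (a - \<epsilon>)))" if \<epsilon>: "0 < \<epsilon>" for \<epsilon>
    proof -
      obtain r where "0 \<le> r" and r: "\<And>\<beta>. r * measure_pmf.expectation \<beta> f - DV_information Q \<pi> \<beta>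
          \<le> r * u - (a - \<epsilon>)"
        using exists_tangent_slope[OF mean \<open>0 \<le> u\<close> \<beta>\<^sub>0 lower \<epsilon>] by blast
      show ?thesis
        using additive_functional_tail_le[OF gen assms(4) \<open>0 < t\<close> \<open>0 \<le> r\<close> r, where u = u and \<nu> = \<nu>]
        by simp
    qed
    then have "\<forall>\<^sub>F \<epsilon> in at_right 0. ?p t u \<le> ?d * exp (- (t * (a - \<epsilon>)))"
      using eventually_at_right_less[of "0 :: real"] by (auto elim: eventually_mono)
    moreover have "((\<lambda>\<epsilon>. ?d * exp (- (t * (a - \<epsilon>)))) \<longlongrightarrow> ?d * exp (- (t * (a - 0)))) (at_right 0)"
      by (intro tendsto_intros)
    ultimately have "?p t u \<le> ?d * exp (- (t * a))"
      using tendsto_lowerbound[of _ _ "at_right (0 :: real)" "?p t u"] by simp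
    then show ?thesis
      by (simp add: a exp_ereal_def)
  qed
  moreover have "ereal (lambda0 Q \<pi> f r) \<le> fenchel_conjugate \<alpha> r" if "0 \<le> r" for r
  proof -
    obtain \<beta>' where opt: "\<And>\<beta>. r * measure_pmf.expectation \<beta> f - DV_information Q \<pi> \<beta>
        \<le> r * measure_pmf.expectation \<beta>' f - DV_information Q \<pi> \<beta>'"
      using exists_optimal_measure[where r = r and f = f] by blast
    note \<lambda> = lambda0_variational[OF opt]
    \<comment> \<open>For \<open>r = 0\<close> a maximiser might have negative mean, but \<open>\<pi>\<close> is then a maximiser too.\<close>
    obtain \<beta> where \<beta>: "0 \<le> measure_pmf.expectation \<beta> f"
        "lambda0 Q \<pi> f r \<le> r * measure_pmf.expectation \<beta> f - DV_information Q \<pi> \<beta>"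
    proof (cases "r = 0")
      case True
      show ?thesis
        using \<lambda> DV_information_nonneg[of \<beta>'] that[of \<pi>] True
        by (simp add: mean DV_information_stationary)
    next
      case False
      have "0 \<le> r * measure_pmf.expectation \<beta>' f - DV_information Q \<pi> \<beta>'"
        using opt[of \<pi>] by (simp add: mean DV_information_stationary)
      then have "0 \<le> r * measure_pmf.expectation \<beta>' f"
        using DV_information_nonneg[of \<beta>'] by simp
      then have "0 \<le> measure_pmf.expectation \<beta>' f"
        using False \<open>0 \<le> r\<close> by (simp add: zero_le_mult_iff)
      then show ?thesis
        using that[of \<beta>'] \<lambda> by simp
    qed
    let ?u = "measure_pmf.expectation \<beta> f"
    have "ereal (lambda0 Q \<pi> f r) \<le> ereal (r * ?u) - ereal (DV_information Q \<pi> \<beta>)"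
      using \<beta>(2) by simp
    also have "\<dots> \<le> ereal (r * ?u) - \<alpha> ?u"
      by (intro ereal_minus_mono \<alpha>_le \<beta>(1)) simp
    also have "\<dots> \<le> fenchel_conjugate \<alpha> r"
      unfolding fenchel_conjugate_def using \<beta>(1) by (intro SUP_upper) simp
    finally show ?thesis .
  qed
  ultimately show ?thesis by blast
qed

end
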